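(* Let $T=\{T_1,T_2;p_1,p_2\}$ be the position dependent random map described in the context, and assume that conditions (A) and (B) of the context hold. Then: (i) $T$ admits a unique absolutely continuous invariant probability measure (ACIM) $\mu$, $d\mu=\rho\,dm$. (ii) The invariant density $\rho$ is uniformly bounded below, i.e. there is a constant $c>0$ such that $\rho\ge c$ $m$-almost everywhere on $[0,1]$.
   Context: Let $I=[0,1]$ with its Borel $\sigma$-algebra $\mathcal{B}(I)$ and Lebesgue measure $m$. Let $0<\beta<\alpha<1$ and define $T_1,T_2:I\to I$ by $$T_1(x)=\begin{cases}x(1+2^{\alpha}x^{\alpha}), & x\in[0,\tfrac12),\\ g_1(x), & x\in[\tfrac12,1],\end{cases}\qquad T_2(x)=\begin{cases}x(1+2^{\beta}x^{\beta}), & x\in[0,\tfrac12),\\ g_2(x), & x\in[\tfrac12,1],\end{cases}$$ where $g_k:[\tfrac12,1]\to[0,1]$ is differentiable with $g_k(\tfrac12)=0$ and $g_k'(x)>1$ for $k=1,2$ (the $g_k$ need not be onto). Let $p_1,p_2:I\to[0,1]$ be measurable with $p_1(x)+p_2(x)=1$ for all $x$. The position dependent random map $T=\{T_1,T_2;p_1,p_2\}$ is the Markov process on $I$ with transition function $\mathbb{P}(x,B)=p_1(x)\chi_B(T_1(x))+p_2(x)\chi_B(T_2(x))$, $B\in\mathcal{B}(I)$. A measure $\mu$ is $T$-invariant if $\mu(B)=\int_{T_1^{-1}(B)}p_1\,d\mu+\int_{T_2^{-1}(B)}p_2\,d\mu$ for every $B\in\mathcal{B}(I)$. An ACIM of $T$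 is a $T$-invariant probability measure that is absolutely continuous with respect to $m$; its density is called an invariant density. For $k=1,2$ let $T_{k,1}$ and $T_{k,2}$ denote the branches of $T_k$ on $[0,\tfrac12)$ and $[\tfrac12,1]$ respectively. "Decreasing" means non-increasing. Conditions: (A) For $k=1,2$ and $l=1,2$, the function $x\mapsto\sum_{i=1}^{l}\dfrac{p_k(T_{k,i}^{-1}(x))}{T_k'(T_{k,i}^{-1}(x))}$ is decreasing on $[0,1)$, where a term is taken to be $0$ when $x$ is not in the image of $T_{k,i}$, and derivatives at the endpoint $\tfrac12$ are one-sided. (B) There is $\delta>0$ such that $\inf_{x\in I}p_k(x)\ge\delta$ for $k=1,2$. *)

theory Defs
  imports "HOL-Probability.Probability"
begin

abbreviation unit_interval :: "real set" where
  "unit_interval \<equiv> {0..1}"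

definition borel01 :: "real measure" where
  "borel01 = restrict_space borel unit_interval"

definition leb01 :: "real measure" where
  "leb01 = restrict_space lborel unit_interval"

definition intermittent_map :: "real \<Rightarrow> (real \<Rightarrow> real) \<Rightarrow> real \<Rightarrow> real" where
  "intermittent_map \<gamma> g x =
     (if x < 1/2 then x * (1 + 2 powr \<gamma> * x powr \<gamma>) else g x)"

definition right_branch :: "(real \<Rightarrow> real) \<Rightarrow> bool" where
  "right_branch g \<longleftrightarrow>
     g \<in> {1/2..1} \<rightarrow> unit_interval \<and> g (1/2) = 0 \<and>
     (\<forall>x\<in>{1/2..1}. \<exists>D>1. (g has_real_derivative D) (at x within {1/2..1}))"

text \<open>In the following definitions the random map is given by its constituent maps
  \<open>T1\<close>, \<open>T2\<close> and probabilities \<open>p1\<close>, \<open>p2\<close>, which only matter on the unit interval.\<close>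

definition random_map_invariant ::
  "(real \<Rightarrow> real) \<Rightarrow> (real \<Rightarrow> real) \<Rightarrow> (real \<Rightarrow> real) \<Rightarrow> (real \<Rightarrow> real) \<Rightarrow> real measure \<Rightarrow> bool" where
  "random_map_invariant T1 T2 p1 p2 \<mu> \<longleftrightarrow>
     sets \<mu> = sets borel01 \<and>
     (\<forall>B\<in>sets borel01.
        emeasure \<mu> B =
          (\<integral>\<^sup>+x\<in>T1 -` B. ennreal (p1 x) \<partial>\<mu>) + (\<integral>\<^sup>+x\<in>T2 -` B. ennreal (p2 x) \<partial>\<mu>))"

definition acim ::
  "(real \<Rightarrow> real) \<Rightarrow> (real \<Rightarrow> real) \<Rightarrow> (real \<Rightarrow> real) \<Rightarrow> (real \<Rightarrow> real) \<Rightarrow> real measure \<Rightarrow> bool" where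
  "acim T1 T2 p1 p2 \<mu> \<longleftrightarrow>
     prob_space \<mu> \<and> random_map_invariant T1 T2 p1 p2 \<mu> \<and> absolutely_continuous leb01 \<mu>"

definition is_density :: "real measure \<Rightarrow> (real \<Rightarrow> real) \<Rightarrow> bool" where
  "is_density \<mu> \<rho> \<longleftrightarrow>
     \<rho> \<in> borel_measurable leb01 \<and> (\<forall>x\<in>unit_interval. 0 \<le> \<rho> x) \<and>
     \<mu> = density leb01 (\<lambda>x. ennreal (\<rho> x))"

definition branch_dom :: "nat \<Rightarrow> real set" where
  "branch_dom i = (if i = 1 then {0..<1/2} else {1/2..1})"

text \<open>The derivative is taken within the domain of the branch, hence one-sided at
  the endpoints.\<close>

definition branch_weight :: "(real \<Rightarrow> real) \<Rightarrow> (real \<Rightarrow> real) \<Rightarrow> nat \<Rightarrow> real \<Rightarrow> real" where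
  "branch_weight T p i x =
     (if x \<in> T ` branch_dom i then
        (let y = inv_into (branch_dom i) T x
         in p y / vector_derivative T (at y within branch_dom i))
      else 0)"

definition condition_A :: "(real \<Rightarrow> real) \<Rightarrow> (real \<Rightarrow> real) \<Rightarrow> bool" where
  "condition_A T p \<longleftrightarrow>
     (\<forall>l\<in>{1,2::nat}. antimono_on {0..<1} (\<lambda>x. \<Sum>i=1..l. branch_weight T p i x))"

definition condition_B :: "(real \<Rightarrow> real) \<Rightarrow> (real \<Rightarrow> real) \<Rightarrow> bool" where
  "condition_B p1 p2 \<longleftrightarrow>
     (\<exists>\<delta>>0. (INF x\<in>unit_interval. p1 x) \<ge> \<delta> \<and> (INF x\<in>unit_interval. p2 x) \<ge> \<delta>)"

end

theory Submission
  imports Defs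
begin

text \<open>Invariance is studied through a dual pair of operators: the averaging operator
  \<open>U\<close> on test functions (one step of the Markov process) and the transfer operator \<open>P\<close> on densities,
  linked by \<open>\<integral> \<phi> \<cdot> P f = \<integral> U \<phi> \<cdot> f\<close>. Condition (A) is what makes \<open>P\<close> map decreasing
  densities to decreasing densities (\<open>transfer_op_antimono\<close>): it says that the weight of the left preimage,
  where a decreasing density is larger, and the total weight of both preimages decrease.

  The only place where mass could get stuck is the neutral fixed point \<open>0\<close>. Let \<open>y(x)\<close> be the left
  preimage of \<open>x\<close> under \<open>T1\<close>, the map that is flatter at \<open>0\<close>. Mass in \<open>[0,x]\<close> comes either from
  \<open>[0,y(x)]\<close> or from an interval of length at most \<open>x\<close> to the right of \<open>1/2\<close>, where a decreasing
  probability density is at most \<open>2\<close>. Iterating, the mass of \<open>[0,x]\<close> after \<open>n\<close> steps is at most its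
  initial mass in \<open>[0,y^n(x)]\<close> plus \<open>2 \<Sum> y^j(x)\<close>, and since \<open>\<alpha> < 1\<close> this sum is bounded by a multiple
  of \<open>x^(1-\<alpha>)\<close>; the function \<open>V\<close> with \<open>V(x) - V(y(x)) \<ge> x\<close> encodes this. So whatever decreasing
  density one starts from, eventually at most half of the mass lies in a fixed \<open>[0,\<epsilon>]\<close>, which forces
  a decreasing density to be at least \<open>1/2\<close> on \<open>[0,\<epsilon>]\<close>; condition (B) spreads this bound along the
  left branches over all of \<open>[0,1)\<close>. The outcome is \<open>uniform_positivity\<close>: one constant \<open>c > 0\<close> bounds
  \<open>P^n\<close> of every normalised indicator \<open>1[0,s)/s\<close> from below for all large \<open>n\<close>.

  Existence and the lower bound: \<open>l = liminf P^n 1\<close> satisfies \<open>P l \<le> l\<close>, has integral at most \<open>1\<close> by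
  Fatou and is at least \<open>c\<close>; as \<open>P\<close> preserves integrals, \<open>P l = l\<close> almost everywhere, so \<open>l\<close> normalised
  is an invariant density (\<open>ex_stationary\<close>).

  Uniqueness: if \<open>v\<close> is a second invariant density and \<open>u \<ge> c\<close> is the first, a balance of the mass
  flowing in and out of \<open>A = {u < v}\<close> shows that \<open>U 1_A = 1_A\<close>, i.e. that \<open>A\<close> is an invariant set. The maps
  are merely differentiable, so distortion and density-point arguments are not at hand. Instead,
  consider the proportion \<open>m(A \<inter> [0,s)) / s\<close>. It equals the mass that \<open>P^n\<close> of \<open>1[0,s)/s\<close> gives to
  \<open>A\<close>; that density is \<open>c\<close> plus a decreasing function, hence \<open>c\<close> plus a mixture of uniform densities on
  initial segments. So the supremum \<open>M\<close> of all proportions satisfies \<open>M \<le> c m(A) + (1 - c) M\<close>, that is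
  \<open>M \<le> m(A)\<close>. The same for the complement gives \<open>m(A \<inter> [0,s)) = m(A) s\<close> for all \<open>s\<close>, whence
  \<open>m(A) = m(A)^2\<close> (\<open>invariant_set_trivial\<close>), so \<open>u\<close> and \<open>v\<close> are comparable and therefore equal
  (\<open>stationary_unique\<close>).\<close>


section \<open>Decreasing functions on the unit interval\<close>

lemma space_leb01 [simp]: "space leb01 = unit_interval"
  by (simp add: leb01_def space_restrict_space)

lemma sets_leb01: "sets leb01 = sets borel01"
  by (simp add: leb01_def borel01_def sets_restrict_space)

lemma sets_leb01_iff: "A \<in> sets leb01 \<longleftrightarrow> A \<in> sets borel \<and> A \<subseteq> unit_interval"
  by (simp add: leb01_def sets_restrict_space_iff conj_commute)

lemma emeasure_leb01: "A \<subseteq> unit_interval \<Longrightarrow> emeasure leb01 A = emeasure lborel A"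
  by (simp add: leb01_def emeasure_restrict_space)

lemma nn_integral_leb01:
  "(\<integral>\<^sup>+x. f x \<partial>leb01) = (\<integral>\<^sup>+x. f x * indicator unit_interval x \<partial>lborel)"
  by (simp add: leb01_def nn_integral_restrict_space)

lemma finite_measure_leb01: "finite_measure leb01"
  by (rule finite_measureI) (simp add: emeasure_leb01)

lemma borel_measurable_leb01_iff:
  fixes f :: "real \<Rightarrow> ennreal"
  shows "f \<in> borel_measurable leb01 \<longleftrightarrow> (\<lambda>x. f x * indicator unit_interval x) \<in> borel_measurable borel"
proof -
  have "borel_measurable leb01 = (borel_measurable (restrict_space borel unit_interval) :: (real \<Rightarrow> ennreal) set)"
    by (rule measurable_cong_sets) (simp_all add: leb01_def sets_restrict_space)
  then show ?thesis by (simp add: borel_measurable_restrict_space_iff_ennreal)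
qed

lemma borel_measurable_antimono_on_interval:
  fixes f :: "real \<Rightarrow> 'a :: {linorder_topology, second_countable_topology}"
  assumes "antimono_on S f" "is_interval S"
  shows "f \<in> borel_measurable (restrict_space borel S)"
proof (rule borel_measurableI_greater)
  fix y
  have "is_interval {x \<in> S. y < f x}"
    unfolding is_interval_1
  proof safe
    fix a b x assume *: "a \<in> S" "b \<in> S" "y < f b" "a \<le> x" "x \<le> b"
    show xS: "x \<in> S" using assms(2) * unfolding is_interval_1 by blast
    have "f b \<le> f x" using assms(1) * xS by (auto simp: monotone_on_def)
    with * show "y < f x" by simp
  qed
  then have "{x \<in> S. y < f x} \<in> sets borel" by (rule real_interval_borel_measurable)
  moreover have "S \<in> sets borel" using assms(2) by (rule real_interval_borel_measurable)
  ultimately show "{x \<in> space (restrict_space borel S). y < f x} \<in> sets (restrict_space borel S)"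
    by (simp add: sets_restrict_space_iff space_restrict_space)
qed

lemma borel_measurable_antimono_leb01:
  fixes f :: "real \<Rightarrow> ennreal"
  assumes "antimono_on unit_interval f"
  shows "f \<in> borel_measurable leb01"
proof -
  have "borel_measurable leb01 = (borel_measurable (restrict_space borel unit_interval) :: (real \<Rightarrow> ennreal) set)"
    by (rule measurable_cong_sets) (simp_all add: leb01_def sets_restrict_space)
  then show ?thesis
    using borel_measurable_antimono_on_interval[OF assms] by (simp add: is_interval_cc)
qed

text \<open>An initial segment is \<open>[0,s)\<close> or \<open>[0,s]\<close>; up to a null set it is the half-open one.\<close>
lemma emeasure_initial_segment:
  assumes A: "A \<in> sets leb01" and J: "J \<subseteq> unit_interval" "J \<noteq> {}"
    and down: "\<And>x y. y \<in> J \<Longrightarrow> 0 \<le> x \<Longrightarrow> x \<le> y \<Longrightarrow> x \<in> J"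
  shows "\<exists>s\<in>unit_interval. emeasure leb01 (A \<inter> J) = emeasure leb01 (A \<inter> {0..<s}) \<and> emeasure leb01 J = s"
proof -
  let ?s = "Sup J"
  have bdd: "bdd_above J" using J(1) by (intro bdd_aboveI[of _ 1]) auto
  have up: "x \<le> ?s" if "x \<in> J" for x using that bdd by (rule cSup_upper)
  have s: "?s \<in> unit_interval"
  proof -
    obtain x where x: "x \<in> J" using J(2) by blast
    then have "0 \<le> ?s" using J(1) up[OF x] by force
    moreover have "?s \<le> 1" using J by (intro cSup_least) auto
    ultimately show ?thesis by simp
  qed
  have sub: "{0..<?s} \<subseteq> J"
  proof
    fix x assume x: "x \<in> {0..<?s}"
    then obtain y where "y \<in> J" "x < y" using less_cSup_iff[OF J(2) bdd] by auto
    then show "x \<in> J" using down[of y x] x by auto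
  qed
  have sup: "J \<subseteq> {0..?s}" using J up by auto
  have "J = {0..<?s} \<or> J = {0..?s}"
  proof (cases "?s \<in> J")
    case True
    then have "{0..?s} \<subseteq> J" using down by auto
    then show ?thesis using sup by blast
  next
    case False
    have "J \<subseteq> {0..<?s}"
    proof
      fix x assume "x \<in> J"
      moreover from this False have "x \<noteq> ?s" by blast
      ultimately show "x \<in> {0..<?s}" using sup by force
    qed
    then show ?thesis using sub by blast
  qed
  then have Jm: "J \<in> sets borel" by (metis atLeastAtMost_borel atLeastLessThan_borel)
  have Am: "A \<in> sets borel" "A \<subseteq> unit_interval" using A by (auto simp: sets_leb01_iff)
  have in_J: "x \<in> J \<longleftrightarrow> 0 \<le> x \<and> x < ?s" if "x \<noteq> ?s" for x
    using subsetD[OF sub, of x] subsetD[OF sup, of x] that by auto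
  have "emeasure lborel (A \<inter> J) = emeasure lborel (A \<inter> {0..<?s})"
  proof (rule emeasure_eq_AE)
    show "AE x in lborel. (x \<in> A \<inter> J) = (x \<in> A \<inter> {0..<?s})"
      using AE_lborel_singleton[of ?s] by eventually_elim (simp add: in_J)
  qed (use Am Jm in auto)
  moreover have "emeasure lborel J = emeasure lborel {0..?s}"
  proof (rule emeasure_eq_AE)
    show "AE x in lborel. (x \<in> J) = (x \<in> {0..?s})"
      using AE_lborel_singleton[of ?s] by eventually_elim (auto simp: in_J)
  qed (use Am Jm in auto)
  ultimately show ?thesis using s J Am Jm
    by (intro bexI[of _ ?s]) (auto simp: emeasure_leb01 sets_leb01_iff le_infI1)
qed

text \<open>A decreasing function is a mixture of indicators of its superlevel sets, which are initial segments
  of the interval (layer-cake formula). A bound on the proportion of \<open>A\<close> in every initial segment thus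
  bounds the share that \<open>A\<close> receives of any decreasing density.\<close>
lemma nn_integral_antimono_le:
  fixes k :: "real \<Rightarrow> ennreal"
  assumes k: "antimono_on unit_interval k" and A: "A \<in> sets leb01"
    and le: "\<And>s. s \<in> {0<..1} \<Longrightarrow> emeasure leb01 (A \<inter> {0..<s}) \<le> c * ennreal s"
  shows "(\<integral>\<^sup>+x. k x * indicator A x \<partial>leb01) \<le> c * (\<integral>\<^sup>+x. k x \<partial>leb01)"
proof -
  interpret finite_measure leb01 by (rule finite_measure_leb01)
  interpret pair_sigma_finite leb01 lborel
    unfolding pair_sigma_finite_def using sigma_finite_lborel sigma_finite_measure by simp
  have [measurable]: "k \<in> borel_measurable leb01" using k by (rule borel_measurable_antimono_leb01)
  note A[measurable]
  let ?J = "\<lambda>t. {x \<in> unit_interval. ennreal t < k x}"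
  have layer: "k x = (\<integral>\<^sup>+t. indicator {0..} t * indicator {t. ennreal t < k x} t \<partial>lborel)" for x
  proof (cases "k x")
    case (real r)
    have "(\<integral>\<^sup>+t. indicator {0..} t * indicator {t. ennreal t < k x} t \<partial>lborel) = (\<integral>\<^sup>+t. indicator {0..<r} t \<partial>lborel)"
      using real by (intro nn_integral_cong) (auto simp: indicator_def ennreal_less_iff)
    then show ?thesis using real by simp
  next
    case top
    have "(\<integral>\<^sup>+t. indicator {0..} t * indicator {t. ennreal t < k x} t \<partial>lborel) = (\<integral>\<^sup>+t. indicator {0::real..} t \<partial>lborel)"
      using top by (intro nn_integral_cong) (auto simp: indicator_def)
    also have "\<dots> = top"
    proof -
      have "of_nat n \<le> emeasure lborel {0::real..}" for n
        using emeasure_mono[of "{0..real n}" "{0..}" lborel] by (simp add: ennreal_of_nat_eq_real_of_nat)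
      then have "(SUP n. of_nat n) \<le> emeasure lborel {0::real..}" by (rule SUP_least)
      then show ?thesis by (simp add: ennreal_SUP_of_nat_eq_top top_unique)
    qed
    finally show ?thesis using top by simp
  qed
  have swap: "(\<integral>\<^sup>+x. k x * indicator B x \<partial>leb01) =
      (\<integral>\<^sup>+t. indicator {0..} t * emeasure leb01 (B \<inter> ?J t) \<partial>lborel)" if [measurable]: "B \<in> sets leb01" for B
  proof -
    have "(\<integral>\<^sup>+x. k x * indicator B x \<partial>leb01) =
      (\<integral>\<^sup>+x. (\<integral>\<^sup>+t. indicator {0..} t * indicator {t. ennreal t < k x} t * indicator B x \<partial>lborel) \<partial>leb01)"
      by (subst layer) (simp add: nn_integral_multc)
    also have "\<dots> = (\<integral>\<^sup>+t. (\<integral>\<^sup>+x. indicator {0..} t * indicator {t. ennreal t < k x} t * indicator B x \<partial>leb01) \<partial>lborel)"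
      by (intro Fubini'[symmetric]) measurable
    also have "\<dots> = (\<integral>\<^sup>+t. (\<integral>\<^sup>+x. indicator {0..} t * indicator (B \<inter> ?J t) x \<partial>leb01) \<partial>lborel)"
      by (intro nn_integral_cong) (auto simp: indicator_def)
    also have "\<dots> = (\<integral>\<^sup>+t. indicator {0..} t * emeasure leb01 (B \<inter> ?J t) \<partial>lborel)"
    proof (intro nn_integral_cong)
      fix t
      have "?J t = {x \<in> space leb01. ennreal t < k x}" by simp
      also have "\<dots> \<in> sets leb01" by measurable
      finally have Jt[measurable]: "?J t \<in> sets leb01" .
      show "(\<integral>\<^sup>+x. indicator {0..} t * indicator (B \<inter> ?J t) x \<partial>leb01) = indicator {0..} t * emeasure leb01 (B \<inter> ?J t)"
        by (rule nn_integral_cmult_indicator) (intro sets.Int Jt that)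
    qed
    finally show ?thesis .
  qed
  have "emeasure leb01 (A \<inter> ?J t) \<le> c * emeasure leb01 (unit_interval \<inter> ?J t)" for t
  proof (cases "?J t = {}")
    case True
    then show ?thesis by (simp only: Int_empty_right emeasure_empty) simp
  next
    case False
    have "\<exists>s\<in>unit_interval. emeasure leb01 (A \<inter> ?J t) = emeasure leb01 (A \<inter> {0..<s}) \<and> emeasure leb01 (?J t) = s"
    proof (rule emeasure_initial_segment[OF A _ False])
      fix x y assume "y \<in> ?J t" "0 \<le> x" "x \<le> y"
      moreover from this have "k y \<le> k x" using k by (auto simp: monotone_on_def)
      ultimately show "x \<in> ?J t" by auto
    qed auto
    then obtain s where s: "s \<in> unit_interval" "emeasure leb01 (A \<inter> ?J t) = emeasure leb01 (A \<inter> {0..<s})"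
      "emeasure leb01 (?J t) = s" by blast
    have "unit_interval \<inter> ?J t = ?J t" by auto
    with s le[of s] show ?thesis by (cases "s = 0") auto
  qed
  then have "(\<integral>\<^sup>+x. k x * indicator A x \<partial>leb01) \<le>
      (\<integral>\<^sup>+t. c * (indicator {0..} t * emeasure leb01 (unit_interval \<inter> ?J t)) \<partial>lborel)"
    unfolding swap[OF A] by (intro nn_integral_mono) (auto simp: indicator_def)
  also have "\<dots> = c * (\<integral>\<^sup>+t. indicator {0..} t * emeasure leb01 (unit_interval \<inter> ?J t) \<partial>lborel)"
  proof (rule nn_integral_cmult)
    have "(\<lambda>t. indicator {0..} t * emeasure leb01 {x\<in>space leb01. ennreal t < k x}) \<in> borel_measurable lborel"
      by measurable
    moreover have "unit_interval \<inter> ?J t = {x\<in>space leb01. ennreal t < k x}" for t by auto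
    ultimately show "(\<lambda>t. indicator {0..} t * emeasure leb01 (unit_interval \<inter> ?J t)) \<in> borel_measurable lborel" by simp
  qed
  also have "(\<integral>\<^sup>+t. indicator {0..} t * emeasure leb01 (unit_interval \<inter> ?J t) \<partial>lborel) = (\<integral>\<^sup>+x. k x * indicator unit_interval x \<partial>leb01)"
    by (rule swap[symmetric]) (simp add: sets_leb01_iff)
  also have "\<dots> = (\<integral>\<^sup>+x. k x \<partial>leb01)"
    by (intro nn_integral_cong) (auto simp: indicator_def)
  finally show ?thesis .
qed

text \<open>The difference \<open>g - f\<close> is nonnegative with vanishing integral.\<close>
lemma AE_eq_of_le_of_nn_integral_le:
  fixes f g :: "'a \<Rightarrow> ennreal"
  assumes [measurable]: "f \<in> borel_measurable M" "g \<in> borel_measurable M"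
    and le: "AE x in M. f x \<le> g x" and int: "(\<integral>\<^sup>+x. g x \<partial>M) \<le> (\<integral>\<^sup>+x. f x \<partial>M)"
    and fin: "(\<integral>\<^sup>+x. f x \<partial>M) \<noteq> \<infinity>"
  shows "AE x in M. f x = g x"
proof -
  have "(\<integral>\<^sup>+x. g x - f x \<partial>M) = (\<integral>\<^sup>+x. g x \<partial>M) - (\<integral>\<^sup>+x. f x \<partial>M)"
    using fin le by (intro nn_integral_diff) auto
  also have "\<dots> = 0" using int fin by (auto intro!: diff_eq_0_ennreal simp: less_top[symmetric] top_unique)
  finally have "AE x in M. g x - f x = 0" by (simp add: nn_integral_0_iff_AE)
  moreover have "AE x in M. f x \<noteq> \<infinity>" using fin by (intro nn_integral_PInf_AE) auto
  ultimately show ?thesis using le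
  proof eventually_elim
    case (elim x)
    from elim(3) have "(g x - f x) + f x = g x" by (rule diff_add_cancel_ennreal)
    then show ?case unfolding elim(1) by simp
  qed
qed

lemma AE_leb01_neq: "AE x in leb01. x \<noteq> (c :: real)"
proof -
  have "AE x in lborel. x \<in> unit_interval \<longrightarrow> x \<noteq> c" using AE_lborel_singleton[of c] by eventually_elim simp
  then show ?thesis unfolding leb01_def by (subst AE_restrict_space_iff) simp_all
qed

lemma unit_interval_sets [measurable, simp]: "unit_interval \<in> sets leb01"
  by (simp add: sets_leb01_iff)

lemma nn_integral_leb01_ge:
  fixes l :: "real \<Rightarrow> ennreal"
  assumes "c > 0" "\<And>x. x \<in> {0..<1} \<Longrightarrow> ennreal c \<le> l x"
  shows "ennreal c \<le> (\<integral>\<^sup>+x. l x \<partial>leb01)"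
proof -
  have "ennreal c = ennreal c * emeasure leb01 {0..<1}" by (subst emeasure_leb01) auto
  also have "\<dots> = (\<integral>\<^sup>+x. ennreal c * indicator {0..<1} x \<partial>leb01)"
    by (rule nn_integral_cmult_indicator[symmetric]) (auto simp: sets_leb01_iff)
  also have "\<dots> \<le> (\<integral>\<^sup>+x. l x \<partial>leb01)"
    using assms by (intro nn_integral_mono) (auto simp: indicator_def)
  finally show ?thesis .
qed

section \<open>Change of variables along a branch\<close>

text \<open>The derivative is one-sided at the endpoints and need not be continuous: the fundamental
  theorem for the gauge integral covers this, and nonnegativity turns its value into a Lebesgue
  integral.\<close>
lemma nn_integral_FTC_within:
  fixes G d :: "real \<Rightarrow> real"
  assumes ab: "a \<le> b"
    and G: "\<And>x. x \<in> {a..b} \<Longrightarrow> (G has_real_derivative d x) (at x within {a..b})"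
    and d: "\<And>x. x \<in> {a..b} \<Longrightarrow> 0 \<le> d x"
    and [measurable]: "(\<lambda>x. d x * indicator {a..b} x) \<in> borel_measurable borel"
  shows "(\<integral>\<^sup>+x. ennreal (d x) * indicator {a..b} x \<partial>lborel) = ennreal (G b - G a)"
proof -
  have "(d has_integral G b - G a) {a..b}"
    using G ab by (intro fundamental_theorem_of_calculus) (auto simp: has_real_derivative_iff_has_vector_derivative)
  then have "((\<lambda>x. d x * indicator {a..b} x) has_integral G b - G a) UNIV"
    unfolding indicator_def of_bool_def if_distrib[where f="\<lambda>x. a * x" for a]
    by (simp cong del: if_weak_cong del: atLeastAtMost_iff)
  then have "(\<integral>\<^sup>+x. ennreal (d x * indicator {a..b} x) \<partial>lborel) = ennreal (G b - G a)"
  proof (rule nn_integral_has_integral_lborel[rotated 2])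
    show "0 \<le> d x * indicator {a..b} x" for x using d[of x] by (cases "x \<in> {a..b}") auto
  qed (rule assms(4))
  also have "(\<integral>\<^sup>+x. ennreal (d x * indicator {a..b} x) \<partial>lborel) = (\<integral>\<^sup>+x. ennreal (d x) * indicator {a..b} x \<partial>lborel)"
    by (intro nn_integral_cong) (auto simp: indicator_def)
  finally show ?thesis .
qed

text \<open>Both sides integrate \<open>H\<close> against finite Borel measures, the image of \<open>d(x) dx\<close> under \<open>G\<close> and Lebesgue
  measure on \<open>[G a, G b]\<close>. They agree on all rays \<open>(z,\<infinity>)\<close> by the fundamental theorem of calculus.\<close>
lemma nn_integral_increasing_substitution:
  fixes G d :: "real \<Rightarrow> real" and H :: "real \<Rightarrow> ennreal"
  assumes ab: "a \<le> b"
    and G: "\<And>x. x \<in> {a..b} \<Longrightarrow> (G has_real_derivative d x) (at x within {a..b})"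
    and d: "\<And>x. x \<in> {a..b} \<Longrightarrow> 0 \<le> d x"
    and G_mono: "strict_mono_on {a..b} G"
    and d_meas: "(\<lambda>x. d x * indicator {a..b} x) \<in> borel_measurable borel"
    and [measurable]: "H \<in> borel_measurable borel"
  shows "(\<integral>\<^sup>+x. H (G x) * ennreal (d x) * indicator {a..b} x \<partial>lborel) =
         (\<integral>\<^sup>+y. H y * indicator {G a..G b} y \<partial>lborel)"
proof -
  have G_le: "G x \<le> G y" if "a \<le> x" "x \<le> y" "y \<le> b" for x y
    using strict_mono_on_leD[OF G_mono, of x y] that by auto
  have G_less: "G x < G y \<longleftrightarrow> x < y" if "x \<in> {a..b}" "y \<in> {a..b}" for x y
    using strict_mono_on_less[OF G_mono that] by auto
  have cont: "continuous_on {a..b} G"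
    using G by (meson DERIV_continuous continuous_on_eq_continuous_within)
  \<comment> \<open>\<open>G\<close> is unspecified outside \<open>[a,b]\<close>; the constant extension is monotone, hence measurable.\<close>
  define G' where "G' x = G (max a (min b x))" for x
  have "mono G'" using ab by (auto simp: mono_def G'_def intro!: G_le)
  then have [measurable]: "G' \<in> borel_measurable borel" by (rule borel_measurable_mono)
  have G'_eq: "G' x = G x" if "x \<in> {a..b}" for x using that by (simp add: G'_def)
  define e where "e x = ennreal (d x) * indicator {a..b} x" for x
  have "e = (\<lambda>x. ennreal (d x * indicator {a..b} x))" by (auto simp: e_def indicator_def)
  with d_meas have [measurable]: "e \<in> borel_measurable borel" by simp
  have ftc: "(\<integral>\<^sup>+x. ennreal (d x) * indicator {c..b} x \<partial>lborel) = ennreal (G b - G c)" if "c \<in> {a..b}" for c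
  proof (rule nn_integral_FTC_within)
    show "c \<le> b" using that by simp
    show "(G has_real_derivative d x) (at x within {c..b})" if "x \<in> {c..b}" for x
      using DERIV_subset[OF G, of x "{c..b}"] that \<open>c \<in> {a..b}\<close> by auto
    show "0 \<le> d x" if "x \<in> {c..b}" for x using d that \<open>c \<in> {a..b}\<close> by auto
    have "(\<lambda>x. d x * indicator {a..b} x * indicator {c..b} x) \<in> borel_measurable borel"
      using d_meas by measurable
    also have "(\<lambda>x. d x * indicator {a..b} x * indicator {c..b} x) = (\<lambda>x. d x * indicator {c..b} x)"
      using that by (auto simp: indicator_def)
    finally show "(\<lambda>x. d x * indicator {c..b} x) \<in> borel_measurable borel" .
  qed
  have "distr (density lborel e) borel G' = density lborel (indicator {G a..G b})"
  proof (rule measure_eqI_lessThan)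
    fix z
    have L: "emeasure (distr (density lborel e) borel G') {z<..} = (\<integral>\<^sup>+x. e x * indicator {x. z < G' x} x \<partial>lborel)"
      by (simp add: emeasure_distr emeasure_density vimage_def)
    have R: "emeasure (density lborel (indicator {G a..G b})) {z<..} = emeasure lborel ({G a..G b} \<inter> {z<..})"
    proof -
      have "emeasure (density lborel (indicator {G a..G b})) {z<..} =
          (\<integral>\<^sup>+y. indicator {G a..G b} y * indicator {z<..} y \<partial>lborel)"
        by (subst emeasure_density) simp_all
      also have "\<dots> = (\<integral>\<^sup>+y. indicator ({G a..G b} \<inter> {z<..}) y \<partial>lborel)"
        by (intro nn_integral_cong) (simp add: indicator_def)
      also have "\<dots> = emeasure lborel ({G a..G b} \<inter> {z<..})"
        by (rule nn_integral_indicator) simp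
      finally show ?thesis .
    qed
    show eq: "emeasure (distr (density lborel e) borel G') {z<..} = emeasure (density lborel (indicator {G a..G b})) {z<..}"
    proof -
      consider "z < G a" | "G b < z" | c where "c \<in> {a..b}" "z = G c"
        using IVT'[of G a z b] ab cont by force
      then show ?thesis
      proof cases
        case 1
        then have "z < G x" if "x \<in> {a..b}" for x using G_le[of a x] that by auto
        then have "(\<integral>\<^sup>+x. e x * indicator {x. z < G' x} x \<partial>lborel) = (\<integral>\<^sup>+x. e x \<partial>lborel)"
          by (intro nn_integral_cong) (auto simp: e_def indicator_def G'_eq)
        also have "\<dots> = ennreal (G b - G a)" unfolding e_def using ab by (intro ftc) auto
        also have "\<dots> = emeasure lborel ({G a..G b} \<inter> {z<..})"
        proof -
          have "{G a..G b} \<inter> {z<..} = {G a..G b}" using 1 by auto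
          then show ?thesis using G_le[of a b] ab by simp
        qed
        finally show ?thesis unfolding L R .
      next
        case 2
        then have "\<not> z < G x" if "x \<in> {a..b}" for x using G_le[of x b] that by auto
        then have "(\<integral>\<^sup>+x. e x * indicator {x. z < G' x} x \<partial>lborel) = integral\<^sup>N lborel (\<lambda>x::real. 0)"
          by (intro nn_integral_cong) (auto simp: e_def indicator_def G'_eq)
        moreover have "{G a..G b} \<inter> {z<..} = {}" using 2 by auto
        ultimately show ?thesis unfolding L R by simp
      next
        case 3
        have "(\<integral>\<^sup>+x. e x * indicator {x. z < G' x} x \<partial>lborel) = (\<integral>\<^sup>+x. ennreal (d x) * indicator {c..b} x \<partial>lborel)"
        proof (rule nn_integral_cong_AE)
          show "AE x in lborel. e x * indicator {x. z < G' x} x = ennreal (d x) * indicator {c..b} x"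
            using AE_lborel_singleton[of c]
          proof eventually_elim
            case (elim x)
            then show ?case using 3 G_less[of c x] by (auto simp: e_def indicator_def G'_eq)
          qed
        qed
        also have "\<dots> = ennreal (G b - G c)" using 3 by (intro ftc) auto
        also have "\<dots> = emeasure lborel ({G a..G b} \<inter> {z<..})"
        proof -
          have "{G a..G b} \<inter> {z<..} = {z<..G b}" using 3 G_le[of a c] by auto
          then show ?thesis using 3 G_le[of c b] by simp
        qed
        finally show ?thesis unfolding L R .
      qed
    qed
    have "emeasure lborel ({G a..G b} \<inter> {z<..}) \<le> emeasure lborel {G a..G b}"
      by (intro emeasure_mono) auto
    also have "\<dots> < \<infinity>" by (simp add: emeasure_lborel_Icc_eq)
    finally show "emeasure (distr (density lborel e) borel G') {z<..} < \<infinity>" unfolding eq R .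
  qed simp_all
  then have "(\<integral>\<^sup>+y. H y \<partial>distr (density lborel e) borel G') = (\<integral>\<^sup>+y. H y \<partial>density lborel (indicator {G a..G b}))"
    by simp
  then have "(\<integral>\<^sup>+x. e x * H (G' x) \<partial>lborel) = (\<integral>\<^sup>+y. indicator {G a..G b} y * H y \<partial>lborel)"
    by (simp add: nn_integral_distr nn_integral_density)
  moreover have "(\<integral>\<^sup>+x. e x * H (G' x) \<partial>lborel) = (\<integral>\<^sup>+x. H (G x) * ennreal (d x) * indicator {a..b} x \<partial>lborel)"
    by (intro nn_integral_cong) (auto simp: e_def indicator_def G'_eq mult.commute)
  ultimately show ?thesis by (simp add: mult.commute)
qed

lemma antimono_on_times_indicator_measurable:
  fixes f :: "real \<Rightarrow> ennreal"
  assumes "antimono_on S f" "is_interval S"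
  shows "(\<lambda>x. f x * indicator S x) \<in> borel_measurable borel"
  using borel_measurable_antimono_on_interval[OF assms] real_interval_borel_measurable[OF assms(2)]
  by (simp add: borel_measurable_restrict_space_iff_ennreal)

lemma antimono_on_times_indicator_measurable_real:
  fixes f :: "real \<Rightarrow> real"
  assumes "antimono_on S f" "is_interval S"
  shows "(\<lambda>x. f x * indicator S x) \<in> borel_measurable borel"
  using borel_measurable_antimono_on_interval[OF assms] real_interval_borel_measurable[OF assms(2)]
  by (simp add: borel_measurable_restrict_space_iff mult.commute)

text \<open>Substituting \<open>y = G x\<close> cancels the derivative in the weight \<open>p / d\<close>. The domain \<open>D\<close> may lack its
  right endpoint \<open>b\<close>, which is how the half-open left branch is covered by a closed interval. The
  measurability of the derivative \<open>d\<close> is recovered from that of the weight: \<open>d = p / (W \<circ> T)\<close> on \<open>[a,b)\<close>, where \<open>p\<close> is positive.\<close>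
lemma branch_duality:
  fixes T G d p W :: "real \<Rightarrow> real" and f \<phi> :: "real \<Rightarrow> ennreal"
  assumes ab: "a \<le> b" "{a..b} \<subseteq> unit_interval"
    and D: "{a..<b} \<subseteq> D" "D \<subseteq> {a..b}"
    and deriv: "\<And>x. x \<in> {a..b} \<Longrightarrow> (G has_real_derivative d x) (at x within {a..b})"
    and d_pos: "\<And>x. x \<in> {a..b} \<Longrightarrow> 0 < d x"
    and G_mono: "strict_mono_on {a..b} G" and G_range: "G \<in> {a..b} \<rightarrow> unit_interval"
    and T: "\<And>x. x \<in> D \<Longrightarrow> T x = G x"
    and W: "\<And>x. x \<in> D \<Longrightarrow> W (T x) = p x / d x" "\<And>y. y \<notin> T ` D \<Longrightarrow> W y = 0"
    and W_meas: "(\<lambda>y. W y * indicator {0..<1} y) \<in> borel_measurable borel"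
    and p_meas: "(\<lambda>x. p x * indicator unit_interval x) \<in> borel_measurable borel"
    and p_pos: "\<And>x. x \<in> unit_interval \<Longrightarrow> 0 < p x"
    and f: "antimono_on unit_interval f" and \<phi>[measurable]: "\<phi> \<in> borel_measurable borel"
  shows "(\<lambda>y. \<phi> y * (ennreal (W y) * f (inv_into D T y)) * indicator {0..<1} y) \<in> borel_measurable borel"
      (is "?meas")
    and "(\<integral>\<^sup>+y. \<phi> y * (ennreal (W y) * f (inv_into D T y)) * indicator {0..<1} y \<partial>lborel) =
         (\<integral>\<^sup>+x. \<phi> (T x) * (ennreal (p x) * f x) * indicator D x \<partial>lborel)" (is "?eq")
proof -
  have T_less: "T x < T y \<longleftrightarrow> x < y" if "x \<in> D" "y \<in> D" for x y
    using strict_mono_on_less[OF G_mono, of x y] that subsetD[OF D(2)] by (simp add: T)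
  have T_le: "T x \<le> T y \<longleftrightarrow> x \<le> y" if "x \<in> D" "y \<in> D" for x y
    using T_less[of y x] that by (meson not_le)
  have inj: "inj_on T D" by (rule inj_onI) (metis T_less less_irrefl linorder_neqE)
  have G_le: "G x \<le> G y" if "a \<le> x" "x \<le> y" "y \<le> b" for x y
    using strict_mono_on_leD[OF G_mono, of x y] that by auto
  have cont: "continuous_on {a..b} G"
    using deriv by (meson DERIV_continuous continuous_on_eq_continuous_within)
  have D_interval: "is_interval D"
    unfolding is_interval_1
  proof safe
    fix x y z assume *: "x \<in> D" "y \<in> D" "x \<le> z" "z \<le> y"
    show "z \<in> D"
    proof (cases "z = b")
      case True with * D show ?thesis by (metis atLeastAtMost_iff order_antisym subset_eq)
    next
      case False
      with * D have "z \<in> {a..<b}" by (auto dest!: subsetD[OF D(2)])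
      with D show ?thesis by blast
    qed
  qed
  have "connected (G ` D)"
    using D_interval cont D(2) by (intro connected_continuous_image) (auto intro: continuous_on_subset simp: is_interval_connected_1)
  moreover have "G ` D = T ` D" using T by auto
  ultimately have TD_interval: "is_interval (T ` D)" by (simp add: is_interval_connected_1)
  then have TD_meas[measurable]: "T ` D \<in> sets borel" by (rule real_interval_borel_measurable)
  have f_inv: "antimono_on (T ` D) (\<lambda>y. f (inv_into D T y))"
  proof (rule monotone_onI)
    fix y z assume "y \<in> T ` D" "z \<in> T ` D" "y \<le> z"
    then obtain x x' where "x \<in> D" "x' \<in> D" "y = T x" "z = T x'" by auto
    with T_le \<open>y \<le> z\<close> have "x \<le> x'" by simp
    moreover have "x \<in> unit_interval" "x' \<in> unit_interval" using \<open>x \<in> D\<close> \<open>x' \<in> D\<close> D ab by auto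
    ultimately show "f (inv_into D T z) \<le> f (inv_into D T y)"
      using f \<open>y = T x\<close> \<open>z = T x'\<close> \<open>x \<in> D\<close> \<open>x' \<in> D\<close> inj by (auto simp: monotone_on_def)
  qed
  have [measurable]: "(\<lambda>y. f (inv_into D T y) * indicator (T ` D) y) \<in> borel_measurable borel"
    by (rule antimono_on_times_indicator_measurable[OF f_inv TD_interval])
  note W_meas[measurable] p_meas[measurable]
  \<comment> \<open>The integrand with redundant indicators, each of which makes one factor Borel on the whole line.\<close>
  define H where "H y = \<phi> y * (ennreal (W y * indicator {0..<1} y) * (f (inv_into D T y) * indicator (T ` D) y))" for y
  have [measurable]: "H \<in> borel_measurable borel" unfolding H_def by measurable
  have TD01: "T x \<in> {0..<1}" "x \<in> D" if "x \<in> {a..<b}" for x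
  proof -
    show xD: "x \<in> D" using that D by auto
    have "G x < G b" using strict_mono_onD[OF G_mono, of x b] that by auto
    moreover have "G b \<le> 1" "0 \<le> G x" using G_range that ab by auto
    ultimately show "T x \<in> {0..<1}" using T[OF xD] by auto
  qed
  have d_meas: "(\<lambda>x. d x * indicator {a..b} x) \<in> borel_measurable borel"
  proof -
    define G' where "G' x = G (max a (min b x))" for x
    have "mono G'" using ab by (auto simp: mono_def G'_def intro!: G_le)
    then have [measurable]: "G' \<in> borel_measurable borel" by (rule borel_measurable_mono)
    have "(\<lambda>x. d x * indicator {a..b} x) =
      (\<lambda>x. (p x * indicator unit_interval x) / (W (G' x) * indicator {0..<1} (G' x)) * indicator {a..<b} x + d b * indicator {b} x)"
    proof
      fix x
      consider "x \<in> {a..<b}" | "x = b" | "x \<notin> {a..b}" by force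
      then show "d x * indicator {a..b} x =
        (p x * indicator unit_interval x) / (W (G' x) * indicator {0..<1} (G' x)) * indicator {a..<b} x + d b * indicator {b} x"
      proof cases
        case 1
        then have "G' x = T x" using TD01(2) T by (simp add: G'_def)
        moreover have "x \<in> unit_interval" using ab 1 by auto
        ultimately show ?thesis
          using TD01[OF 1] 1 W(1)[of x] p_pos[of x] d_pos[of x] ab by (auto simp: indicator_def)
      qed (use ab in \<open>auto simp: indicator_def\<close>)
    qed
    also have "\<dots> \<in> borel_measurable borel"
    proof -
      have "(\<lambda>x. W (G' x) * indicator {0..<1} (G' x)) \<in> borel_measurable borel"
        using measurable_compose[OF \<open>G' \<in> borel_measurable borel\<close> W_meas] .
      then show ?thesis by measurable
    qed
    finally show ?thesis .
  qed
  have "(\<lambda>y. \<phi> y * (ennreal (W y) * f (inv_into D T y)) * indicator {0..<1} y) = H"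
    using W(2) by (auto simp: H_def indicator_def fun_eq_iff)
  then show ?meas by simp
  have "(\<integral>\<^sup>+y. \<phi> y * (ennreal (W y) * f (inv_into D T y)) * indicator {0..<1} y \<partial>lborel) =
      (\<integral>\<^sup>+y. H y * indicator {G a..G b} y \<partial>lborel)"
  proof (rule nn_integral_cong)
    fix y
    have "y \<in> {G a..G b}" if "y \<in> T ` D"
    proof -
      from that obtain x where "x \<in> D" "y = G x" using T by auto
      then show ?thesis using D ab by (auto intro!: G_le)
    qed
    then show "\<phi> y * (ennreal (W y) * f (inv_into D T y)) * indicator {0..<1} y = H y * indicator {G a..G b} y"
      using W(2)[of y] by (auto simp: H_def indicator_def)
  qed
  also have "\<dots> = (\<integral>\<^sup>+x. H (G x) * ennreal (d x) * indicator {a..b} x \<partial>lborel)"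
    using nn_integral_increasing_substitution[OF ab(1) deriv less_imp_le[OF d_pos] G_mono d_meas, of H] by simp
  also have "\<dots> = (\<integral>\<^sup>+x. \<phi> (T x) * (ennreal (p x) * f x) * indicator D x \<partial>lborel)"
  proof (rule nn_integral_cong_AE)
    show "AE x in lborel. H (G x) * ennreal (d x) * indicator {a..b} x = \<phi> (T x) * (ennreal (p x) * f x) * indicator D x"
      using AE_lborel_singleton[of b]
    proof eventually_elim
      case (elim x)
      show ?case
      proof (cases "x \<in> {a..<b}")
        case True
        note 1 = TD01[OF this]
        have x: "x \<in> {a..b}" "x \<in> unit_interval" using True ab by auto
        have "ennreal (p x / d x) * ennreal (d x) = ennreal (p x)"
          using d_pos[OF x(1)] p_pos[OF x(2)] by (simp flip: ennreal_mult')
        then have "ennreal (p x / d x) * f x * ennreal (d x) = ennreal (p x) * f x"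
          by (metis mult.assoc mult.commute)
        moreover have "inv_into D T (T x) = x" using 1 inj by simp
        then have "H (T x) = \<phi> (T x) * (ennreal (p x / d x) * f x)"
          using 1 W(1)[of x] by (simp add: H_def)
        then have "H (G x) = \<phi> (T x) * (ennreal (p x / d x) * f x)" using T[of x] 1 by simp
        ultimately show ?thesis using 1 x by (simp add: mult.assoc)
      next
        case False
        then have "x \<notin> {a..b}" "x \<notin> D" using elim D by force+
        then show ?thesis by simp
      qed
    qed
  qed
  finally show ?eq .
qed

section \<open>The transfer operator of a single map\<close>

text \<open>At \<open>1\<close>, where the weights are not controlled, the value is set to \<open>0\<close>: this changes the
  operator on a null set only and keeps decreasing functions decreasing on the closed interval.
  Outside the image of a branch the corresponding weight vanishes, so that the arbitrary value
  of \<open>inv_into\<close> there has no effect.\<close>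
definition transfer_op :: "(real \<Rightarrow> real) \<Rightarrow> (real \<Rightarrow> real) \<Rightarrow> (real \<Rightarrow> ennreal) \<Rightarrow> real \<Rightarrow> ennreal" where
  "transfer_op T p f x =
     (if x < 1 then \<Sum>i\<in>{1,2}. ennreal (branch_weight T p i x) * f (inv_into (branch_dom i) T x) else 0)"

locale weighted_intermittent_map =
  fixes \<gamma> \<delta> :: real and g p T :: "real \<Rightarrow> real"
  assumes exponent: "0 < \<gamma>" "\<gamma> < 1"
    and right: "right_branch g"
    and T_eq: "T = intermittent_map \<gamma> g"
    and p_meas: "p \<in> borel_measurable borel01"
    and p_range: "p \<in> unit_interval \<rightarrow> unit_interval"
    and lower: "0 < \<delta>" "\<And>x. x \<in> unit_interval \<Longrightarrow> \<delta> \<le> p x"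
    and decreasing: "condition_A T p"
begin

text \<open>The formula of the left branch, continued to the closed interval \<open>[0,1/2]\<close> on which the change of
  variables takes place.\<close>
definition left :: "real \<Rightarrow> real" where
  "left z = z * (1 + 2 powr \<gamma> * z powr \<gamma>)"

definition left' :: "real \<Rightarrow> real" where
  "left' z = 1 + (1 + \<gamma>) * 2 powr \<gamma> * z powr \<gamma>"

definition right' :: "real \<Rightarrow> real" where
  "right' z = (SOME D. D > 1 \<and> (g has_real_derivative D) (at z within {1/2..1}))"

text \<open>At \<open>0\<close> the product rule is not available, because \<open>z powr \<gamma>\<close> is not differentiable there; the
  difference quotient is computed directly.\<close>
lemma left_deriv:
  assumes "z \<in> {0..1/2}"
  shows "(left has_real_derivative left' z) (at z within {0..1/2})"
proof (cases "z = 0")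
  case True
  have "((\<lambda>y. 1 + 2 powr \<gamma> * y powr \<gamma>) \<longlongrightarrow> 1 + 2 powr \<gamma> * 0 powr \<gamma>) (at 0 within {0..1/2})"
    by (intro tendsto_intros tendsto_powr2)
       (use exponent in \<open>auto simp: eventually_at_filter\<close>)
  moreover have "\<forall>\<^sub>F y in at 0 within {0..1/2}. 1 + 2 powr \<gamma> * y powr \<gamma> = (left y - left 0) / (y - 0)"
    by (auto simp: eventually_at_filter left_def)
  ultimately have "((\<lambda>y. (left y - left 0) / (y - 0)) \<longlongrightarrow> 1 + 2 powr \<gamma> * 0 powr \<gamma>) (at 0 within {0..1/2})"
    by (rule Lim_transform_eventually)
  then show ?thesis using True by (simp add: has_field_derivative_iff left'_def)
next
  case False
  then have "z > 0" using assms by simp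
  have "z * (\<gamma> * z powr (\<gamma> - 1)) = \<gamma> * z powr \<gamma>"
    using \<open>z > 0\<close> by (simp add: powr_diff)
  then have eq: "(1 + 2 powr \<gamma> * z powr \<gamma>) + z * (2 powr \<gamma> * (\<gamma> * z powr (\<gamma> - 1))) = left' z"
    by (simp add: left'_def algebra_simps)
  have "(left has_real_derivative ((1 + 2 powr \<gamma> * z powr \<gamma>) + z * (2 powr \<gamma> * (\<gamma> * z powr (\<gamma> - 1))))) (at z within {0..1/2})"
    unfolding left_def using \<open>z > 0\<close> by (auto intro!: derivative_eq_intros)
  then show ?thesis unfolding eq .
qed

lemma left'_bounds: "z \<in> {0..1/2} \<Longrightarrow> 1 \<le> left' z \<and> left' z \<le> 3"
proof -
  assume z: "z \<in> {0..1/2}"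
  have "2 powr \<gamma> * z powr \<gamma> = (2 * z) powr \<gamma>" using z by (simp add: powr_mult)
  moreover have "(2 * z) powr \<gamma> \<le> 1" using z exponent by (intro powr_le1) auto
  ultimately have le: "2 powr \<gamma> * z powr \<gamma> \<le> 1" by simp
  have "(1 + \<gamma>) * (2 powr \<gamma> * z powr \<gamma>) \<le> 2 * 1"
    using exponent le by (intro mult_mono) auto
  then show ?thesis using exponent by (simp add: left'_def mult.assoc)
qed

lemma left_strict_mono: "strict_mono_on {0..1/2} left"
proof (rule strict_mono_onI)
  fix x y :: real assume *: "x \<in> {0..1/2}" "y \<in> {0..1/2}" "x < y"
  have "x powr \<gamma> \<le> y powr \<gamma>" using * exponent by (intro powr_mono2) auto
  then have "x * (1 + 2 powr \<gamma> * x powr \<gamma>) \<le> x * (1 + 2 powr \<gamma> * y powr \<gamma>)"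
    using * by (intro mult_left_mono) auto
  also have "\<dots> < y * (1 + 2 powr \<gamma> * y powr \<gamma>)"
    using * by (intro mult_strict_right_mono add_pos_nonneg) auto
  finally show "left x < left y" unfolding left_def .
qed

lemma left_0 [simp]: "left 0 = 0" and left_half [simp]: "left (1/2) = 1"
proof -
  have "(2::real) powr \<gamma> * (1/2) powr \<gamma> = 1" by (simp flip: powr_mult)
  then show "left (1/2) = 1" by (simp add: left_def)
qed (simp add: left_def)

lemma left_range: "left \<in> {0..1/2} \<rightarrow> unit_interval"
  using strict_mono_on_leD[OF left_strict_mono, of 0] strict_mono_on_leD[OF left_strict_mono, of _ "1/2"] by auto

lemma left_ge: "0 \<le> z \<Longrightarrow> z \<le> left z"
  by (simp add: left_def mult_left_le algebra_simps)

lemma right'_spec: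
  assumes "z \<in> {1/2..1}"
  shows "1 < right' z" "(g has_real_derivative right' z) (at z within {1/2..1})"
proof -
  have "\<exists>D. D > 1 \<and> (g has_real_derivative D) (at z within {1/2..1})"
    using right assms unfolding right_branch_def by blast
  from someI_ex[OF this] show "1 < right' z" "(g has_real_derivative right' z) (at z within {1/2..1})"
    by (simp_all add: right'_def)
qed

lemma right_expanding:
  assumes "1/2 \<le> x" "x < y" "y \<le> 1"
  shows "y - x < g y - g x"
proof -
  have "\<exists>\<xi>. \<xi>\<in>{x<..<y} \<and> g y - g x = (y - x) * right' \<xi>"
  proof -
    have "\<exists>\<xi>\<in>{x<..<y}. g y - g x = (\<lambda>h. h * right' \<xi>) (y - x)"
    proof (rule mvt_simple)
      fix z assume z: "x \<le> z" "z \<le> y"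
      have "(g has_real_derivative right' z) (at z within {x..y})"
        using z assms by (intro DERIV_subset[OF right'_spec(2)]) auto
      then show "(g has_derivative (\<lambda>h. h * right' z)) (at z within {x..y})"
        by (simp add: has_field_derivative_def mult.commute[of _ "right' z"])
    qed (use assms in auto)
    then show ?thesis by auto
  qed
  then obtain \<xi> where \<xi>: "\<xi> \<in> {x<..<y}" "g y - g x = (y - x) * right' \<xi>" by auto
  have "1 < right' \<xi>" using \<xi>(1) assms by (intro right'_spec) auto
  then have "(y - x) * 1 < (y - x) * right' \<xi>" using assms by (intro mult_strict_left_mono) auto
  then show ?thesis using \<xi> by simp
qed

lemma right_strict_mono: "strict_mono_on {1/2..1} g"
  by (rule strict_mono_onI) (use right_expanding in force)

lemma right_half: "g (1/2) = 0"
  using right by (simp add: right_branch_def)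

lemma right_ge:
  assumes "z \<in> {1/2..1}" shows "z - 1/2 \<le> g z"
proof (cases "z = 1/2")
  case True then show ?thesis by (simp only: right_half)
next
  case False with assms show ?thesis using right_expanding[of "1/2" z] right_half by simp
qed

lemma right_range: "g \<in> {1/2..1} \<rightarrow> unit_interval"
  using right by (simp add: right_branch_def)

lemma right_cont: "continuous_on {1/2..1} g"
  using right'_spec(2) by (meson DERIV_continuous continuous_on_eq_continuous_within)

lemma left_cont: "continuous_on {0..1/2} left"
  using left_deriv by (meson DERIV_continuous continuous_on_eq_continuous_within)

lemma T_left: "x < 1/2 \<Longrightarrow> T x = left x" and T_right: "1/2 \<le> x \<Longrightarrow> T x = g x"
  by (simp_all add: T_eq intermittent_map_def left_def)

lemma T_range: "T \<in> unit_interval \<rightarrow> unit_interval"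
proof
  fix x :: real assume "x \<in> unit_interval"
  then show "T x \<in> unit_interval"
    using left_range right_range T_left[of x] T_right[of x] by (cases "x < 1/2") (auto simp: Pi_iff)
qed

lemma T_measurable [measurable]: "(\<lambda>x. T x * indicator unit_interval x) \<in> borel_measurable borel"
proof -
  have 1: "(\<lambda>x. indicator {0..1/2} x *\<^sub>R left x) \<in> borel_measurable borel"
    using left_cont by (intro borel_measurable_continuous_on_indicator) auto
  have 2: "(\<lambda>x. indicator {1/2..1} x *\<^sub>R g x) \<in> borel_measurable borel"
    using right_cont by (intro borel_measurable_continuous_on_indicator) auto
  have "(\<lambda>x. T x * indicator unit_interval x) = (\<lambda>x. if x < 1/2 then indicator {0..1/2} x *\<^sub>R left x else indicator {1/2..1} x *\<^sub>R g x)"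
    by (auto simp: indicator_def T_left T_right)
  also have "\<dots> \<in> borel_measurable borel"
    by (rule measurable_If[OF 1 2]) simp
  finally show ?thesis .
qed

lemma image_left: "T ` branch_dom 1 = {0..<1}"
proof -
  have "T ` branch_dom 1 = left ` {0..<1/2}"
    by (auto simp: branch_dom_def T_left intro!: image_cong)
  also have "\<dots> = {0..<1}"
  proof safe
    fix z :: real assume z: "z \<in> {0..<1/2}"
    have "left z < left (1/2)"
      using z by (intro strict_mono_onD[OF left_strict_mono]) auto
    moreover have "left 0 \<le> left z"
      using z by (intro strict_mono_on_leD[OF left_strict_mono]) auto
    ultimately show "left z \<in> {0..<1}" by (simp only: left_0 left_half atLeastLessThan_iff)
  next
    fix x :: real assume x: "x \<in> {0..<1}"
    then obtain z where z: "0 \<le> z" "z \<le> 1/2" "left z = x"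
      using IVT'[of left 0 x "1/2"] left_cont by auto
    then have "z \<noteq> 1/2" using x by (metis atLeastLessThan_iff left_half order.irrefl)
    with z show "x \<in> left ` {0..<1/2}" by force
  qed
  finally show ?thesis .
qed

lemma image_right: "T ` branch_dom 2 = {0..g 1}"
proof -
  have "T ` branch_dom 2 = g ` {1/2..1}"
    by (auto simp: branch_dom_def T_right intro!: image_cong)
  also have "\<dots> = {0..g 1}"
  proof safe
    fix z :: real assume z: "z \<in> {1/2..1}"
    then show "g z \<in> {0..g 1}"
      using strict_mono_on_leD[OF right_strict_mono, of z 1] right_range by auto
  next
    fix x :: real assume x: "x \<in> {0..g 1}"
    then obtain z where "1/2 \<le> z" "z \<le> 1" "g z = x"
      using IVT'[of g "1/2" x 1] right_cont right by (auto simp: right_branch_def)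
    then show "x \<in> g ` {1/2..1}" by force
  qed
  finally show ?thesis .
qed

lemma T_strict_mono_branch: "strict_mono_on (branch_dom i) T"
proof (rule strict_mono_onI)
  fix x y assume "x \<in> branch_dom i" "y \<in> branch_dom i" "x < y"
  then show "T x < T y"
    using strict_mono_onD[OF left_strict_mono, of x y] strict_mono_onD[OF right_strict_mono, of x y]
    by (auto simp: branch_dom_def T_left T_right split: if_splits)
qed

lemma inj_branch: "inj_on T (branch_dom i)"
  using T_strict_mono_branch by (rule strict_mono_on_imp_inj_on)

lemma preimage_mono:
  assumes "x \<in> T ` branch_dom i" "y \<in> T ` branch_dom i" "x \<le> y"
  shows "inv_into (branch_dom i) T x \<le> inv_into (branch_dom i) T y"
proof -
  from assms obtain a b where ab: "a \<in> branch_dom i" "b \<in> branch_dom i" "x = T a" "y = T b" by auto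
  with assms(3) have "a \<le> b" using strict_mono_on_less[OF T_strict_mono_branch, of b i a] by force
  then show ?thesis using ab inj_branch by simp
qed

lemma branch_dom_unit: "branch_dom i \<subseteq> unit_interval"
  by (auto simp: branch_dom_def)

text \<open>The derivative is taken within the domain of the branch, which has no isolated points,
  so every derivative within a larger set determines it.\<close>
lemma branch_weight_at:
  assumes D: "D = branch_dom i" and x: "x \<in> D" and sub: "D \<subseteq> S"
    and deriv: "(G has_real_derivative d) (at x within S)"
    and T: "\<And>z. z \<in> D \<Longrightarrow> T z = G z"
  shows "branch_weight T p i (T x) = p x / d"
proof -
  have "(G has_vector_derivative d) (at x within D)"
    using deriv sub by (auto simp: has_real_derivative_iff_has_vector_derivative[symmetric] intro: DERIV_subset)
  then have "(T has_vector_derivative d) (at x within D)"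
    by (rule has_vector_derivative_transform[OF x, rotated]) (simp add: T)
  moreover have "at x within D \<noteq> bot"
  proof -
    have conn: "connected D" unfolding D branch_dom_def by auto
    have not_single: "\<nexists>a. D = {a}"
    proof
      assume "\<exists>a. D = {a}"
      then obtain a where "D = {a}" by blast
      moreover have "(if i = 1 then 0 else 1/2) \<in> D" "(if i = 1 then 1/4 else 1) \<in> D"
        unfolding D branch_dom_def by auto
      ultimately show False by (auto split: if_splits)
    qed
    show ?thesis using connected_imp_perfect[OF conn x] not_single by (auto simp: trivial_limit_within)
  qed
  ultimately have "vector_derivative T (at x within D) = d" by (rule vector_derivative_within[rotated])
  then show ?thesis using x inj_branch[of i] unfolding D by (simp add: branch_weight_def Let_def)
qed

lemma weight_left:
  assumes "x \<in> {0..<1/2}" shows "branch_weight T p 1 (T x) = p x / left' x"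
  using assms by (intro branch_weight_at[where D="{0..<1/2}" and S="{0..1/2}" and G=left])
     (auto simp: branch_dom_def T_left intro!: left_deriv)

lemma weight_right:
  assumes "x \<in> {1/2..1}" shows "branch_weight T p 2 (T x) = p x / right' x"
  using assms by (intro branch_weight_at[where D="{1/2..1}" and S="{1/2..1}" and G=g])
     (auto simp: branch_dom_def T_right intro!: right'_spec)

lemma weight_outside: "x \<notin> T ` branch_dom i \<Longrightarrow> branch_weight T p i x = 0"
  by (simp add: branch_weight_def)

lemma p_unit: "x \<in> unit_interval \<Longrightarrow> 0 < p x"
  using lower by (meson less_le_trans)

lemma weight_nonneg: "i \<in> {1,2} \<Longrightarrow> 0 \<le> branch_weight T p i x"
proof -
  assume i: "i \<in> {1,2}"
  show ?thesis
  proof (cases "x \<in> T ` branch_dom i")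
    case True
    then obtain z where z: "z \<in> branch_dom i" "x = T z" by auto
    have p0: "0 < p z" using z branch_dom_unit by (auto intro!: p_unit)
    consider "i = 1" | "i = 2" using i by auto
    then show ?thesis
    proof cases
      case 1
      with z have "z \<in> {0..<1/2}" by (simp add: branch_dom_def)
      moreover from this have "0 < left' z" using left'_bounds[of z] by auto
      ultimately show ?thesis using z weight_left[of z] 1 p0 by simp
    next
      case 2
      with z have "z \<in> {1/2..1}" by (simp add: branch_dom_def)
      moreover from this have "0 < right' z" using right'_spec(1)[of z] by auto
      ultimately show ?thesis using z weight_right[of z] 2 p0 by simp
    qed
  qed (simp add: weight_outside)
qed

lemma weight_left_ge:
  assumes "x \<in> {0..<1}" shows "\<delta> / 3 \<le> branch_weight T p 1 x"
proof -
  from assms have "x \<in> T ` branch_dom 1" by (simp only: image_left)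
  then obtain z where z: "z \<in> {0..<1/2}" "x = T z" unfolding branch_dom_def by auto
  have b: "1 \<le> left' z" "left' z \<le> 3" using left'_bounds[of z] z by auto
  have "\<delta> / 3 \<le> p z / left' z"
    using z b lower(1) lower(2)[of z] by (intro frac_le) auto
  then show ?thesis using weight_left z by simp
qed

lemma weight_antimono_1: "antimono_on {0..<1} (branch_weight T p 1)"
  using decreasing by (simp add: condition_A_def)

lemma weight_antimono_2: "antimono_on {0..<1} (\<lambda>x. branch_weight T p 1 x + branch_weight T p 2 x)"
  using decreasing by (simp add: condition_A_def numeral_2_eq_2)

lemma transfer_op_eq:
  "x < 1 \<Longrightarrow> transfer_op T p f x =
     ennreal (branch_weight T p 1 x) * f (inv_into (branch_dom 1) T x) +
     ennreal (branch_weight T p 2 x) * f (inv_into (branch_dom 2) T x)"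
  by (simp add: transfer_op_def)

lemma transfer_op_ge:
  assumes "x \<in> {0..<1}"
  shows "ennreal (\<delta> / 3) * f (inv_into (branch_dom 1) T x) \<le> transfer_op T p f x"
  using assms weight_left_ge[OF assms]
  by (subst transfer_op_eq) (auto intro!: add_increasing2 mult_right_mono ennreal_leI)

text \<open>Write \<open>w1, w2\<close> for the weights and \<open>v1, v2\<close> for the preimages. For \<open>x \<le> y\<close> monotonicity of \<open>f\<close> allows
  to replace \<open>v1(y), v2(y)\<close> by \<open>v1(x), v2(x)\<close>. With \<open>f(v1(x)) = f(v2(x)) + e\<close>, \<open>e \<ge> 0\<close>, the result is
  \<open>(w1 + w2)(y) f(v2(x)) + w1(y) e\<close>, and condition (A) says precisely that both \<open>w1 + w2\<close> and \<open>w1\<close> decrease.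
  If \<open>x\<close> is beyond the image of the right branch, so is \<open>y\<close>, and only \<open>w1\<close> matters.\<close>
lemma transfer_op_antimono:
  assumes f: "antimono_on unit_interval f"
  shows "antimono_on unit_interval (transfer_op T p f)"
proof (rule monotone_onI)
  fix x y :: real assume xy: "x \<in> unit_interval" "y \<in> unit_interval" "x \<le> y"
  let ?w = "branch_weight T p" and ?v = "\<lambda>i. inv_into (branch_dom i) T"
  show "transfer_op T p f y \<le> transfer_op T p f x"
  proof (cases "y < 1")
    case False then show ?thesis by (simp add: transfer_op_def)
  next
    case True
    have w1: "?w 1 y \<le> ?w 1 x" and w12: "?w 1 y + ?w 2 y \<le> ?w 1 x + ?w 2 x"
      using weight_antimono_1 weight_antimono_2 xy True by (auto simp: monotone_on_def)
    have nn: "0 \<le> ?w i z" if "i \<in> {1,2}" for i z using weight_nonneg that by blast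
    have mem: "?v i z \<in> branch_dom i" "?v i z \<in> unit_interval" if "z \<in> T ` branch_dom i" for i z
      using inv_into_into[OF that] branch_dom_unit[of i] by auto
    have f_le: "f b \<le> f a" if "a \<in> unit_interval" "b \<in> unit_interval" "a \<le> b" for a b
      using f that by (auto simp: monotone_on_def)
    have img1: "x \<in> T ` branch_dom 1" "y \<in> T ` branch_dom 1" using xy True unfolding image_left by auto
    have f1: "f (?v 1 y) \<le> f (?v 1 x)"
      using mem[OF img1(1)] mem[OF img1(2)] preimage_mono[OF img1 xy(3)] by (intro f_le)
    show ?thesis
    proof (cases "x \<in> T ` branch_dom 2")
      case False
      then have "y \<notin> T ` branch_dom 2" using xy by (auto simp: image_right)
      then have "transfer_op T p f y = ennreal (?w 1 y) * f (?v 1 y)" "transfer_op T p f x = ennreal (?w 1 x) * f (?v 1 x)"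
        using False xy True by (simp_all add: transfer_op_eq weight_outside)
      then show ?thesis using f1 w1 by (auto intro!: mult_mono ennreal_leI)
    next
      case x2: True
      have f2: "f (?v 2 x) \<le> f (?v 1 x)"
        using mem[OF img1(1)] mem[OF x2] by (intro f_le) (auto simp: branch_dom_def)
      then obtain e where e: "f (?v 1 x) = f (?v 2 x) + e" by (auto simp: le_iff_add)
      have *: "ennreal (?w 2 y) * f (?v 2 y) \<le> ennreal (?w 2 y) * f (?v 2 x)"
      proof (cases "y \<in> T ` branch_dom 2")
        case True
        have "f (?v 2 y) \<le> f (?v 2 x)"
          using mem[OF True] mem[OF x2] preimage_mono[OF x2 True xy(3)] by (intro f_le)
        then show ?thesis by (rule mult_left_mono) simp
      qed (simp add: weight_outside)
      have plus: "ennreal (?w 1 z + ?w 2 z) = ennreal (?w 1 z) + ennreal (?w 2 z)" for z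
        by (intro ennreal_plus nn) auto
      from * have "transfer_op T p f y \<le> ennreal (?w 1 y) * f (?v 1 x) + ennreal (?w 2 y) * f (?v 2 x)"
        using True f1 by (simp add: transfer_op_eq add_mono mult_left_mono)
      also have "\<dots> = ennreal (?w 1 y + ?w 2 y) * f (?v 2 x) + ennreal (?w 1 y) * e"
        unfolding plus e by (simp only: distrib_left distrib_right ac_simps)
      also have "\<dots> \<le> ennreal (?w 1 x + ?w 2 x) * f (?v 2 x) + ennreal (?w 1 x) * e"
        by (rule add_mono) (rule mult_right_mono[OF ennreal_leI[OF w12]] mult_right_mono[OF ennreal_leI[OF w1]], simp)+
      also have "\<dots> = ennreal (?w 1 x) * f (?v 1 x) + ennreal (?w 2 x) * f (?v 2 x)"
        unfolding plus e by (simp only: distrib_left distrib_right ac_simps)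
      also have "\<dots> = transfer_op T p f x" using xy True by (simp add: transfer_op_eq)
      finally show ?thesis .
    qed
  qed
qed

lemma transfer_op_duality:
  assumes f: "antimono_on unit_interval f" and \<phi>: "\<phi> \<in> borel_measurable leb01"
  shows "(\<integral>\<^sup>+x. \<phi> x * transfer_op T p f x \<partial>leb01) = (\<integral>\<^sup>+x. \<phi> (T x) * (ennreal (p x) * f x) \<partial>leb01)"
proof -
  let ?w = "branch_weight T p" and ?v = "\<lambda>i. inv_into (branch_dom i) T"
  define \<psi> where "\<psi> x = \<phi> x * indicator unit_interval x" for x
  have [measurable]: "\<psi> \<in> borel_measurable borel"
    using \<phi> unfolding \<psi>_def by (simp add: borel_measurable_leb01_iff)
  have w1[measurable]: "(\<lambda>y. ?w 1 y * indicator {0..<1} y) \<in> borel_measurable borel"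
    by (rule antimono_on_times_indicator_measurable_real[OF weight_antimono_1]) (simp add: is_interval_co)
  have w12[measurable]: "(\<lambda>y. (?w 1 y + ?w 2 y) * indicator {0..<1} y) \<in> borel_measurable borel"
    by (rule antimono_on_times_indicator_measurable_real[OF weight_antimono_2]) (simp add: is_interval_co)
  have "(\<lambda>y. (?w 1 y + ?w 2 y) * indicator {0..<1} y - ?w 1 y * indicator {0..<1} y) \<in> borel_measurable borel"
    by measurable
  then have w2[measurable]: "(\<lambda>y. ?w 2 y * indicator {0..<1} y) \<in> borel_measurable borel"
    by (simp add: algebra_simps)
  have p[measurable]: "(\<lambda>x. p x * indicator unit_interval x) \<in> borel_measurable borel"
    using p_meas unfolding borel01_def
    by (simp add: borel_measurable_restrict_space_iff mult.commute)
  have D1: "branch_dom 1 = {0..<1/2}" and D2: "branch_dom 2 = {1/2..1}" by (simp_all add: branch_dom_def)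
  define a b where "a i y = \<psi> y * (ennreal (?w i y) * f (?v i y)) * indicator {0..<1} y"
    and "b i x = \<psi> (T x) * (ennreal (p x) * f x) * indicator (branch_dom i) x" for i x y
  have "a 1 \<in> borel_measurable borel \<and> (\<integral>\<^sup>+y. a 1 y \<partial>lborel) = (\<integral>\<^sup>+x. b 1 x \<partial>lborel)"
    unfolding a_def b_def
  proof (intro conjI branch_duality[where a=0 and b="1/2" and G=left and d=left'])
    show "?w 1 (T x) = p x / left' x" if "x \<in> branch_dom 1" for x
      using that weight_left by (simp add: branch_dom_def)
    then show "?w 1 (T x) = p x / left' x" if "x \<in> branch_dom 1" for x using that .
    show "0 < left' x" if "x \<in> {0..1/2}" for x using left'_bounds[OF that] by simp
    then show "0 < left' x" if "x \<in> {0..1/2}" for x using that .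
  qed (use f w1 p left_deriv left_strict_mono left_range p_unit in \<open>auto simp: branch_dom_def T_left weight_outside\<close>)
  moreover have "a 2 \<in> borel_measurable borel \<and> (\<integral>\<^sup>+y. a 2 y \<partial>lborel) = (\<integral>\<^sup>+x. b 2 x \<partial>lborel)"
    unfolding a_def b_def
  proof (intro conjI branch_duality[where a="1/2" and b=1 and G=g and d=right'])
    show "?w 2 (T x) = p x / right' x" if "x \<in> branch_dom 2" for x
      using that weight_right by (simp add: branch_dom_def)
    then show "?w 2 (T x) = p x / right' x" if "x \<in> branch_dom 2" for x using that .
    show "0 < right' x" if "x \<in> {1/2..1}" for x using right'_spec(1)[OF that] by simp
    then show "0 < right' x" if "x \<in> {1/2..1}" for x using that .
  qed (use f w2 p right'_spec right_strict_mono right_range p_unit in \<open>auto simp: branch_dom_def T_right weight_outside\<close>)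
  moreover have b_meas: "b i \<in> borel_measurable borel" if "i \<in> {1,2}" for i
  proof -
    have [measurable]: "(\<lambda>x. f x * indicator unit_interval x) \<in> borel_measurable borel"
      using borel_measurable_antimono_leb01[OF f] by (simp add: borel_measurable_leb01_iff)
    have [measurable]: "branch_dom i \<in> sets borel" using that by (auto simp: branch_dom_def)
    have "b i = (\<lambda>x. \<psi> (T x * indicator unit_interval x) *
        (ennreal (p x * indicator unit_interval x) * (f x * indicator unit_interval x)) * indicator (branch_dom i) x)"
      using branch_dom_unit[of i] by (auto simp: b_def indicator_def fun_eq_iff)
    also have "\<dots> \<in> borel_measurable borel" by measurable
    finally show ?thesis .
  qed
  ultimately have "(\<integral>\<^sup>+y. a 1 y + a 2 y \<partial>lborel) = (\<integral>\<^sup>+x. b 1 x + b 2 x \<partial>lborel)"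
    using b_meas[of 1] b_meas[of 2] by (simp add: nn_integral_add)
  moreover have "(\<integral>\<^sup>+y. a 1 y + a 2 y \<partial>lborel) = (\<integral>\<^sup>+x. \<phi> x * transfer_op T p f x \<partial>leb01)"
    unfolding nn_integral_leb01
  proof (rule nn_integral_cong)
    fix y
    consider "y \<in> {0..<1}" | "y = 1" | "y \<notin> unit_interval" by force
    then show "a 1 y + a 2 y = \<phi> y * transfer_op T p f y * indicator unit_interval y"
    proof cases
      case 1
      then show ?thesis by (simp add: a_def \<psi>_def transfer_op_eq distrib_left)
    qed (auto simp: a_def transfer_op_def)
  qed
  moreover have "(\<integral>\<^sup>+x. b 1 x + b 2 x \<partial>lborel) = (\<integral>\<^sup>+x. \<phi> (T x) * (ennreal (p x) * f x) \<partial>leb01)"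
    unfolding nn_integral_leb01
  proof (rule nn_integral_cong)
    fix x
    show "b 1 x + b 2 x = \<phi> (T x) * (ennreal (p x) * f x) * indicator unit_interval x"
    proof (cases "x \<in> unit_interval")
      case True
      then have "T x \<in> unit_interval" using T_range by (rule funcset_mem[rotated])
      then have "\<psi> (T x) = \<phi> (T x)" unfolding \<psi>_def by (simp only: indicator_simps mult_1_right)
      then show ?thesis using True by (auto simp: b_def branch_dom_def indicator_def)
    qed (auto simp: b_def branch_dom_def)
  qed
  ultimately show ?thesis by simp
qed

lemma T_measurable_leb01 [measurable]: "T \<in> measurable leb01 leb01"
proof -
  have "T \<in> borel_measurable (restrict_space borel unit_interval)"
    using T_measurable by (simp add: borel_measurable_restrict_space_iff mult.commute)
  then have "T \<in> measurable (restrict_space borel unit_interval) (restrict_space borel unit_interval)"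
    using T_range by (intro measurable_restrict_space2) (auto simp: space_restrict_space)
  also have "measurable (restrict_space borel unit_interval) (restrict_space borel unit_interval) = measurable leb01 leb01"
    by (rule measurable_cong_sets) (simp_all add: leb01_def sets_restrict_space)
  finally show ?thesis .
qed

lemma p_measurable_leb01 [measurable]: "p \<in> borel_measurable leb01"
  using p_meas measurable_cong_sets[OF sets_leb01 refl] by blast

lemma transfer_op_SUP:
  assumes "incseq h"
  shows "transfer_op T p (SUP n. h n) x = (SUP n. transfer_op T p (h n) x)"
proof (cases "x < 1")
  case True
  let ?w = "branch_weight T p" and ?v = "\<lambda>i. inv_into (branch_dom i) T"
  have inc: "incseq (\<lambda>n. ennreal (?w i x) * h n (?v i x))" for i
    using assms by (auto simp: incseq_def le_fun_def intro!: mult_left_mono)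
  show ?thesis using True
    by (simp add: transfer_op_eq SUP_mult_left_ennreal ennreal_SUP_add[OF inc inc] image_comp)
qed (simp add: transfer_op_def)

lemma transfer_op_mono: "(\<And>x. f x \<le> h x) \<Longrightarrow> transfer_op T p f x \<le> transfer_op T p h x"
  by (auto simp: transfer_op_def intro!: add_mono mult_left_mono)

end

section \<open>Decreasing densities under the random map\<close>

text \<open>For a left branch with exponent \<open>\<gamma> < 1\<close>, one step from \<open>x\<close> back to its preimage \<open>z\<close> decreases
  \<open>t \<mapsto> 2/(1-\<gamma>) t^(1-\<gamma>)\<close> by at least \<open>x\<close>. Indeed \<open>x - z = 2^\<gamma> z^(1+\<gamma>) \<ge> x^(1+\<gamma>)/2\<close> because \<open>z \<ge> x/2\<close>,
  and the derivative of \<open>t^(1-\<gamma>)\<close> on \<open>[z,x]\<close> is at least \<open>(1-\<gamma>) x^(-\<gamma>)\<close>. Summing along a backward orbit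
  bounds the sum of its points.\<close>
lemma power_gap_bound:
  fixes \<gamma> z x :: real
  assumes \<gamma>: "0 < \<gamma>" "\<gamma> < 1" and z: "0 \<le> z" "z \<le> 1/2"
    and x: "x = z * (1 + 2 powr \<gamma> * z powr \<gamma>)"
  shows "x \<le> 2 / (1 - \<gamma>) * (x powr (1 - \<gamma>) - z powr (1 - \<gamma>))"
proof (cases "z = 0")
  case True then show ?thesis using x by simp
next
  case False
  with z have z0: "z > 0" by simp
  have gap: "x - z = 2 powr \<gamma> * z powr (1 + \<gamma>)"
    using z0 by (simp add: x powr_add algebra_simps)
  have zx: "z < x" using gap z0 by (smt (verit) mult_pos_pos powr_gt_zero)
  have "2 powr \<gamma> * z powr \<gamma> = (2 * z) powr \<gamma>" using z0 by (simp add: powr_mult)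
  also have "\<dots> \<le> 1" using z z0 \<gamma> by (intro powr_le1) auto
  finally have "x \<le> z * (1 + 1)" unfolding x using z by (intro mult_left_mono) auto
  then have x2: "x / 2 \<le> z" by simp
  have "\<exists>\<xi>. z < \<xi> \<and> \<xi> < x \<and> x powr (1-\<gamma>) - z powr (1-\<gamma>) = (x - z) * ((1-\<gamma>) * \<xi> powr (1 - \<gamma> - 1))"
    using zx z0 by (intro MVT2) (auto intro!: derivative_eq_intros)
  then obtain \<xi> where \<xi>: "z < \<xi>" "\<xi> < x" and mvt: "x powr (1-\<gamma>) - z powr (1-\<gamma>) = (x - z) * ((1-\<gamma>) * \<xi> powr (-\<gamma>))"
    by auto
  have "x powr (-\<gamma>) \<le> \<xi> powr (-\<gamma>)" using \<xi> z0 \<gamma> by (intro powr_mono2') auto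
  moreover have "x powr (1 + \<gamma>) / 2 \<le> x - z"
  proof -
    have "x powr (1 + \<gamma>) / 2 = 2 powr \<gamma> * (x / 2) powr (1 + \<gamma>)"
      using zx z0 by (simp add: powr_divide powr_add)
    also have "\<dots> \<le> 2 powr \<gamma> * z powr (1 + \<gamma>)"
      using x2 zx z0 \<gamma> by (intro mult_left_mono powr_mono2) auto
    finally show ?thesis using gap by simp
  qed
  ultimately have "x powr (1 + \<gamma>) / 2 * ((1-\<gamma>) * x powr (-\<gamma>)) \<le> (x - z) * ((1-\<gamma>) * \<xi> powr (-\<gamma>))"
    using \<gamma> zx by (intro mult_mono) auto
  moreover have "x powr (1 + \<gamma>) / 2 * ((1-\<gamma>) * x powr (-\<gamma>)) = (1 - \<gamma>) / 2 * x"
  proof -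
    have "x powr (1 + \<gamma>) * x powr (-\<gamma>) = x" using zx z0 by (simp flip: powr_add)
    then show ?thesis by (simp add: algebra_simps)
  qed
  ultimately have "(1 - \<gamma>) / 2 * x \<le> x powr (1-\<gamma>) - z powr (1-\<gamma>)" using mvt by linarith
  then show ?thesis using \<gamma> by (simp add: field_simps)
qed

locale intermittent_random_map =
  M1: weighted_intermittent_map \<alpha> \<delta> g1 p1 T1 + M2: weighted_intermittent_map \<beta> \<delta> g2 p2 T2
  for \<alpha> \<beta> \<delta> :: real and g1 g2 p1 p2 T1 T2 :: "real \<Rightarrow> real" +
  assumes exponents: "\<beta> \<le> \<alpha>"
    and p_sum: "\<And>x. x \<in> unit_interval \<Longrightarrow> p1 x + p2 x = 1"
begin

text \<open>\<open>P\<close> acts on densities and \<open>U\<close>, its dual, on test functions: \<open>U \<phi> x\<close> is the expected value of \<open>\<phi>\<close> after one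
  step of the process from \<open>x\<close>.\<close>
definition P :: "(real \<Rightarrow> ennreal) \<Rightarrow> real \<Rightarrow> ennreal" where
  "P f x = transfer_op T1 p1 f x + transfer_op T2 p2 f x"

definition U :: "(real \<Rightarrow> ennreal) \<Rightarrow> real \<Rightarrow> ennreal" where
  "U \<phi> x = \<phi> (T1 x) * ennreal (p1 x) + \<phi> (T2 x) * ennreal (p2 x)"

text \<open>The left preimage under \<open>T1\<close>, the map with the larger exponent, together with a Lyapunov function that
  decreases along it (see \<open>V_pull\<close>).\<close>
definition pull :: "real \<Rightarrow> real" where
  "pull = inv_into (branch_dom 1) T1"

definition V :: "real \<Rightarrow> real" where
  "V x = 2 / (1 - \<alpha>) * x powr (1 - \<alpha>)"

lemma P_antimono: "antimono_on unit_interval f \<Longrightarrow> antimono_on unit_interval (P f)"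
  using M1.transfer_op_antimono[of f] M2.transfer_op_antimono[of f]
  by (auto simp: P_def monotone_on_def intro!: add_mono)

lemma P_pow_antimono: "antimono_on unit_interval f \<Longrightarrow> antimono_on unit_interval ((P ^^ n) f)"
  by (induction n) (simp_all add: P_antimono)

lemma U_measurable [measurable]:
  assumes [measurable]: "\<phi> \<in> borel_measurable leb01"
  shows "U \<phi> \<in> borel_measurable leb01"
  unfolding U_def by measurable

lemma P_duality:
  assumes f: "antimono_on unit_interval f" and [measurable]: "\<phi> \<in> borel_measurable leb01"
  shows "(\<integral>\<^sup>+x. \<phi> x * P f x \<partial>leb01) = (\<integral>\<^sup>+x. U \<phi> x * f x \<partial>leb01)"
proof -
  note [measurable] = borel_measurable_antimono_leb01[OF f]
    borel_measurable_antimono_leb01[OF M1.transfer_op_antimono[OF f]]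
    borel_measurable_antimono_leb01[OF M2.transfer_op_antimono[OF f]]
  have "(\<integral>\<^sup>+x. \<phi> x * P f x \<partial>leb01) =
      (\<integral>\<^sup>+x. \<phi> x * transfer_op T1 p1 f x \<partial>leb01) + (\<integral>\<^sup>+x. \<phi> x * transfer_op T2 p2 f x \<partial>leb01)"
    unfolding P_def distrib_left by (rule nn_integral_add) measurable
  also have "\<dots> = (\<integral>\<^sup>+x. \<phi> (T1 x) * (ennreal (p1 x) * f x) \<partial>leb01) + (\<integral>\<^sup>+x. \<phi> (T2 x) * (ennreal (p2 x) * f x) \<partial>leb01)"
    by (simp add: M1.transfer_op_duality[OF f] M2.transfer_op_duality[OF f])
  also have "\<dots> = (\<integral>\<^sup>+x. \<phi> (T1 x) * (ennreal (p1 x) * f x) + \<phi> (T2 x) * (ennreal (p2 x) * f x) \<partial>leb01)"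
    by (rule nn_integral_add[symmetric]) measurable
  also have "\<dots> = (\<integral>\<^sup>+x. U \<phi> x * f x \<partial>leb01)"
    by (simp add: U_def distrib_right mult.assoc)
  finally show ?thesis .
qed

lemma p_sum_ennreal: "x \<in> unit_interval \<Longrightarrow> ennreal (p1 x) + ennreal (p2 x) = 1"
  using p_sum[of x] M1.p_unit[of x] M2.p_unit[of x] by (simp flip: ennreal_plus)

lemma U_const: "x \<in> unit_interval \<Longrightarrow> U (\<lambda>_. 1) x = 1"
  by (simp add: U_def p_sum_ennreal)

lemma P_integral:
  assumes "antimono_on unit_interval f"
  shows "(\<integral>\<^sup>+x. P f x \<partial>leb01) = (\<integral>\<^sup>+x. f x \<partial>leb01)"
proof -
  have "(\<integral>\<^sup>+x. P f x \<partial>leb01) = (\<integral>\<^sup>+x. U (\<lambda>_. 1) x * f x \<partial>leb01)"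
    using P_duality[OF assms, of "\<lambda>_. 1"] by simp
  also have "\<dots> = (\<integral>\<^sup>+x. f x \<partial>leb01)"
    by (intro nn_integral_cong) (simp add: U_const)
  finally show ?thesis .
qed

lemma P_pow_integral:
  assumes "antimono_on unit_interval f"
  shows "(\<integral>\<^sup>+x. (P ^^ n) f x \<partial>leb01) = (\<integral>\<^sup>+x. f x \<partial>leb01)"
  by (induction n) (simp_all add: P_integral P_pow_antimono assms)

lemma pull_props:
  assumes "x \<in> {0..<1}"
  shows "pull x \<in> {0..<1/2}" "T1 (pull x) = x" "x = pull x * (1 + 2 powr \<alpha> * pull x powr \<alpha>)" "pull x \<le> x"
proof -
  have "x \<in> T1 ` branch_dom 1" using assms by (simp only: M1.image_left)
  then show 1: "pull x \<in> {0..<1/2}" and 2: "T1 (pull x) = x"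
    using inv_into_into[of x T1 "branch_dom 1"] f_inv_into_f[of x T1 "branch_dom 1"]
    by (simp_all add: pull_def branch_dom_def)
  show "x = pull x * (1 + 2 powr \<alpha> * pull x powr \<alpha>)"
    using 1 2 M1.T_left[of "pull x"] by (simp add: M1.left_def)
  show "pull x \<le> x" using 1 2 M1.T_left[of "pull x"] M1.left_ge[of "pull x"] by simp
qed

lemma pull_pow: "x \<in> {0..<1} \<Longrightarrow> (pull ^^ n) x \<in> {0..<1}"
  by (induction n) (use pull_props(1) in force)+

lemma V_pull: "x \<in> {0..<1} \<Longrightarrow> V (pull x) + x \<le> V x"
  using power_gap_bound[OF M1.exponent _ _ pull_props(3)] pull_props(1)[of x]
  by (simp add: V_def algebra_simps)

lemma V_nonneg: "0 \<le> V x"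
  using M1.exponent by (simp add: V_def)

text \<open>The points of the backward orbit decrease and their sum is at most \<open>V x\<close>, so the last of \<open>n\<close> points is
  at most \<open>V x / n\<close>.\<close>
lemma pull_pow_decay: "x \<in> {0..<1} \<Longrightarrow> real n * (pull ^^ n) x \<le> V x"
proof (induction n arbitrary: x)
  case 0 then show ?case by (simp add: V_nonneg)
next
  case (Suc n)
  note x = Suc.prems
  have px: "pull x \<in> {0..<1}" using pull_props(1)[OF Suc.prems] by auto
  have le: "(pull ^^ Suc m) x \<le> x" for m
  proof (induction m)
    case 0 then show ?case using pull_props(4)[OF Suc.prems] by simp
  next
    case (Suc m)
    have "(pull ^^ Suc (Suc m)) x \<le> (pull ^^ Suc m) x"
      using pull_props(4)[OF pull_pow[OF x, of "Suc m"]] by simp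
    then show ?case using Suc by simp
  qed
  have "real (Suc n) * (pull ^^ Suc n) x = real n * (pull ^^ n) (pull x) + (pull ^^ Suc n) x"
    by (simp add: algebra_simps funpow_swap1)
  also have "\<dots> \<le> V (pull x) + x" using Suc.IH[OF px] le[of n] by (intro add_mono)
  also have "\<dots> \<le> V x" using V_pull[OF Suc.prems] .
  finally show ?case .
qed

text \<open>Left of \<open>1/2\<close> one has \<open>T1 \<le> T2\<close>, so landing in \<open>[0,x]\<close> under either map means starting left of
  \<open>pull x\<close>. Right of \<open>1/2\<close> the branches have slope larger than \<open>1\<close>, so one has to start within \<open>x\<close>
  of \<open>1/2\<close>.\<close>
lemma U_initial_segment:
  assumes x: "x \<in> {0..<1}" and z: "z \<in> unit_interval"
  shows "U (indicator {0..x}) z \<le> indicator {0..pull x} z + indicator {1/2..1/2 + x} z"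
proof (cases "z < 1/2")
  case True
  have order: "T1 z \<le> T2 z"
  proof -
    have "(2 * z) powr \<alpha> \<le> (2 * z) powr \<beta>"
      using z True exponents by (cases "z = 0") (auto intro!: powr_mono')
    then have "2 powr \<alpha> * z powr \<alpha> \<le> 2 powr \<beta> * z powr \<beta>" using z by (simp add: powr_mult)
    then show ?thesis using True z
      by (simp add: M1.T_left M2.T_left M1.left_def M2.left_def mult_left_mono)
  qed
  show ?thesis
  proof (cases "z \<le> pull x")
    case True
    have "U (indicator {0..x}) z \<le> 1 * ennreal (p1 z) + 1 * ennreal (p2 z)"
      unfolding U_def by (intro add_mono mult_right_mono) (auto simp: indicator_def)
    then show ?thesis using True z by (simp add: p_sum_ennreal add_increasing2)
  next
    case False
    have "T1 (pull x) < T1 z"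
      using strict_mono_onD[OF M1.T_strict_mono_branch[of 1], of "pull x" z] pull_props(1)[OF x] False \<open>z < 1/2\<close>
      by (simp add: branch_dom_def)
    then have "x < T1 z" "x < T2 z" using pull_props(2)[OF x] order by auto
    then show ?thesis by (simp add: U_def)
  qed
next
  case False
  show ?thesis
  proof (cases "z \<le> 1/2 + x")
    case True
    have "U (indicator {0..x}) z \<le> 1 * ennreal (p1 z) + 1 * ennreal (p2 z)"
      unfolding U_def by (intro add_mono mult_right_mono) (auto simp: indicator_def)
    then show ?thesis using True False z by (simp add: p_sum_ennreal add_increasing)
  next
    case 2: False
    have "x < T1 z" "x < T2 z"
      using M1.right_ge[of z] M2.right_ge[of z] 2 False z by (auto simp: M1.T_right M2.T_right)
    then show ?thesis by (simp add: U_def)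
  qed
qed

lemma density_half_le_two:
  assumes f: "antimono_on unit_interval f" and int: "(\<integral>\<^sup>+x. f x \<partial>leb01) = 1"
  shows "f (1/2) \<le> 2"
proof -
  have "f (1/2) * ennreal (1/2) = f (1/2) * emeasure leb01 {0..1/2}"
    by (simp add: emeasure_leb01)
  also have "\<dots> = (\<integral>\<^sup>+x. f (1/2) * indicator {0..1/2} x \<partial>leb01)"
    by (rule nn_integral_cmult_indicator[symmetric]) (simp add: sets_leb01_iff)
  also have "\<dots> \<le> (\<integral>\<^sup>+x. f x \<partial>leb01)"
    using f by (intro nn_integral_mono) (auto simp: indicator_def monotone_on_def)
  finally have "f (1/2) * ennreal (1/2) \<le> 1" using int by simp
  then have "2 * (f (1/2) * ennreal (1/2)) \<le> 2 * 1" by (intro mult_left_mono) auto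
  moreover have "2 * (f (1/2) * ennreal (1/2)) = f (1/2) * (ennreal 2 * ennreal (1/2))" by (simp add: ac_simps)
  moreover have "ennreal 2 * ennreal (1/2) = 1" by (subst ennreal_mult[symmetric]) auto
  ultimately show ?thesis by simp
qed

lemma mass_near_zero_step:
  assumes f: "antimono_on unit_interval f" and int: "(\<integral>\<^sup>+x. f x \<partial>leb01) = 1" and x: "x \<in> {0..<1}"
  shows "(\<integral>\<^sup>+z. indicator {0..x} z * P f z \<partial>leb01) \<le> (\<integral>\<^sup>+z. indicator {0..pull x} z * f z \<partial>leb01) + ennreal (2 * x)"
proof -
  note [measurable] = borel_measurable_antimono_leb01[OF f]
  have px: "pull x \<in> {0..<1/2}" using pull_props(1)[OF x] .
  let ?J = "{1/2..min 1 (1/2 + x)}"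
  have [measurable]: "{0..x} \<in> sets leb01" "{0..pull x} \<in> sets leb01" "?J \<in> sets leb01"
    using x px by (auto simp: sets_leb01_iff)
  have "(\<integral>\<^sup>+z. indicator {0..x} z * P f z \<partial>leb01) = (\<integral>\<^sup>+z. U (indicator {0..x}) z * f z \<partial>leb01)"
    by (rule P_duality[OF f]) measurable
  also have "\<dots> \<le> (\<integral>\<^sup>+z. indicator {0..pull x} z * f z + f (1/2) * indicator ?J z \<partial>leb01)"
  proof (rule nn_integral_mono)
    fix z assume "z \<in> space leb01"
    then have z: "z \<in> unit_interval" by simp
    have "U (indicator {0..x}) z * f z \<le> (indicator {0..pull x} z + indicator {1/2..1/2 + x} z) * f z"
      by (intro mult_right_mono U_initial_segment[OF x z]) simp
    also have "\<dots> = indicator {0..pull x} z * f z + indicator {1/2..1/2 + x} z * f z"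
      by (rule distrib_right)
    also have "\<dots> \<le> indicator {0..pull x} z * f z + f (1/2) * indicator ?J z"
      using f z by (intro add_left_mono) (auto simp: indicator_def monotone_on_def)
    finally show "U (indicator {0..x}) z * f z \<le> indicator {0..pull x} z * f z + f (1/2) * indicator ?J z" .
  qed
  also have "\<dots> = (\<integral>\<^sup>+z. indicator {0..pull x} z * f z \<partial>leb01) + (\<integral>\<^sup>+z. f (1/2) * indicator ?J z \<partial>leb01)"
    by (rule nn_integral_add) measurable
  also have "(\<integral>\<^sup>+z. f (1/2) * indicator ?J z \<partial>leb01) = f (1/2) * emeasure leb01 ?J"
    by (rule nn_integral_cmult_indicator) measurable
  also have "f (1/2) * emeasure leb01 ?J \<le> 2 * ennreal x"
    using x density_half_le_two[OF f int] by (intro mult_mono) (auto simp: emeasure_leb01 intro!: ennreal_leI)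
  also have "2 * ennreal x = ennreal (2 * x)" using x by (simp add: ennreal_mult)
  finally show ?thesis by (simp add: add_left_mono)
qed

text \<open>Each step contributes at most \<open>2 x\<close>, which \<open>V\<close> pays for when passing from \<open>x\<close> to \<open>pull x\<close>. The bound does
  not depend on \<open>f\<close> except through its initial mass near \<open>0\<close>, which disappears as \<open>n\<close> grows.\<close>
lemma mass_near_zero:
  assumes f: "antimono_on unit_interval f" and int: "(\<integral>\<^sup>+x. f x \<partial>leb01) = 1" and x: "x \<in> {0..<1}"
  shows "(\<integral>\<^sup>+z. indicator {0..x} z * (P ^^ n) f z \<partial>leb01)
     \<le> (\<integral>\<^sup>+z. indicator {0..(pull ^^ n) x} z * f z \<partial>leb01) + ennreal (2 * V x)"
  using x
proof (induction n arbitrary: x)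
  case 0 then show ?case by simp
next
  case (Suc n)
  have px: "pull x \<in> {0..<1}" using pull_props(1)[OF Suc.prems] by auto
  have "(\<integral>\<^sup>+z. indicator {0..x} z * (P ^^ Suc n) f z \<partial>leb01) \<le>
     (\<integral>\<^sup>+z. indicator {0..pull x} z * (P ^^ n) f z \<partial>leb01) + ennreal (2 * x)"
    using mass_near_zero_step[OF P_pow_antimono[OF f, of n] _ Suc.prems] P_pow_integral[OF f, of n] int by simp
  also have "\<dots> \<le> ((\<integral>\<^sup>+z. indicator {0..(pull ^^ n) (pull x)} z * f z \<partial>leb01) + ennreal (2 * V (pull x))) + ennreal (2 * x)"
    by (intro add_right_mono Suc.IH px)
  also have "\<dots> = (\<integral>\<^sup>+z. indicator {0..(pull ^^ Suc n) x} z * f z \<partial>leb01) + ennreal (2 * V (pull x) + 2 * x)"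
    using Suc.prems by (simp add: funpow_swap1 add.assoc ennreal_plus V_nonneg)
  also have "\<dots> \<le> (\<integral>\<^sup>+z. indicator {0..(pull ^^ Suc n) x} z * f z \<partial>leb01) + ennreal (2 * V x)"
    using V_pull[OF Suc.prems] by (intro add_left_mono ennreal_leI) simp
  finally show ?case .
qed

text \<open>Only the contribution of the left branch of \<open>T1\<close> is kept; its weight is at least \<open>\<delta> / 3\<close>.\<close>
lemma P_pow_ge_pull:
  "x \<in> {0..<1} \<Longrightarrow> ennreal ((\<delta> / 3) ^ n) * f ((pull ^^ n) x) \<le> (P ^^ n) f x"
proof (induction n arbitrary: x)
  case 0 then show ?case by simp
next
  case (Suc n)
  have px: "pull x \<in> {0..<1}" using pull_props(1)[OF Suc.prems] by auto
  have "ennreal ((\<delta> / 3) ^ Suc n) * f ((pull ^^ Suc n) x) = ennreal (\<delta> / 3) * (ennreal ((\<delta> / 3) ^ n) * f ((pull ^^ n) (pull x)))"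
  proof -
    have "ennreal ((\<delta> / 3) ^ Suc n) = ennreal (\<delta> / 3) * ennreal ((\<delta> / 3) ^ n)"
      unfolding power_Suc using M1.lower(1) by (intro ennreal_mult) auto
    then show ?thesis by (simp only: mult.assoc funpow_Suc_right o_apply)
  qed
  also have "\<dots> \<le> ennreal (\<delta> / 3) * (P ^^ n) f (pull x)"
    by (intro mult_left_mono Suc.IH px) simp
  also have "\<dots> \<le> transfer_op T1 p1 ((P ^^ n) f) x"
    unfolding pull_def by (rule M1.transfer_op_ge[OF Suc.prems])
  also have "\<dots> \<le> (P ^^ Suc n) f x" by (simp add: P_def)
  finally show ?case .
qed

definition uniform_density :: "real \<Rightarrow> real \<Rightarrow> ennreal" where
  "uniform_density s x = ennreal (1 / s) * indicator {..<s} x"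

lemma uniform_density_antimono: "antimono_on unit_interval (uniform_density s)"
  by (auto simp: monotone_on_def uniform_density_def indicator_def)

lemma uniform_density_integral:
  assumes "A \<in> sets leb01"
  shows "(\<integral>\<^sup>+x. indicator A x * uniform_density s x \<partial>leb01) = ennreal (1 / s) * emeasure leb01 (A \<inter> {0..<s})"
proof -
  have A: "A \<inter> {0..<s} \<in> sets leb01" using assms by (auto simp: sets_leb01_iff)
  have "(\<integral>\<^sup>+x. indicator A x * uniform_density s x \<partial>leb01) = (\<integral>\<^sup>+x. ennreal (1 / s) * indicator (A \<inter> {0..<s}) x \<partial>leb01)"
    by (intro nn_integral_cong) (auto simp: uniform_density_def indicator_def)
  also have "\<dots> = ennreal (1 / s) * emeasure leb01 (A \<inter> {0..<s})"
    by (rule nn_integral_cmult_indicator[OF A])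
  finally show ?thesis .
qed

lemma uniform_density_prob:
  assumes "s \<in> {0<..1}"
  shows "(\<integral>\<^sup>+x. uniform_density s x \<partial>leb01) = 1"
proof -
  have "(\<integral>\<^sup>+x. uniform_density s x \<partial>leb01) = (\<integral>\<^sup>+x. indicator unit_interval x * uniform_density s x \<partial>leb01)"
    by (intro nn_integral_cong) (simp add: indicator_def)
  also have "\<dots> = ennreal (1 / s) * emeasure leb01 (unit_interval \<inter> {0..<s})"
    by (rule uniform_density_integral) (simp add: sets_leb01_iff)
  also have "unit_interval \<inter> {0..<s} = {0..<s}" using assms by auto
  also have "ennreal (1 / s) * emeasure leb01 {0..<s} = ennreal (1 / s) * ennreal s"
    using assms by (subst emeasure_leb01) auto
  also have "\<dots> = 1" using assms by (subst ennreal_mult[symmetric]) auto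
  finally show ?thesis .
qed

text \<open>The point \<open>e\<close> is chosen with \<open>V e = 1/8\<close>, so that eventually at most \<open>1/8 + 2/8\<close> of the mass is in
  \<open>[0,e]\<close>. The remaining mass sits on an interval of length below \<open>1\<close>, on which a decreasing density is
  largest at \<open>e\<close>; so it is at least \<open>1/2\<close> at \<open>e\<close> and hence on \<open>[0,e]\<close>. The number \<open>N\<close> is such that \<open>N\<close>
  pullbacks carry all of \<open>[0,1)\<close> into \<open>[0,e]\<close>. Neither \<open>e\<close> nor \<open>N\<close> depends on \<open>s\<close>, which is essential for
  uniqueness; only the waiting time does.\<close>
lemma uniform_positivity:
  "\<exists>c>0. \<forall>s\<in>{0<..1}. \<exists>n0. \<forall>n\<ge>n0. \<forall>x\<in>{0..<1}. ennreal c \<le> (P ^^ n) (uniform_density s) x"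
proof -
  \<comment> \<open>This is the solution of \<open>2/(1-\<alpha>) e^(1-\<alpha>) = 1/8\<close>.\<close>
  define e where "e = ((1 - \<alpha>) / 16) powr (1 / (1 - \<alpha>))"
  have base: "0 < (1 - \<alpha>) / 16" "(1 - \<alpha>) / 16 < 1" using M1.exponent by auto
  have e: "e \<in> {0<..<1}"
    using base M1.exponent powr_less_mono2[of "1 / (1 - \<alpha>)" "(1 - \<alpha>) / 16" 1] by (auto simp: e_def)
  have Ve: "V e = 1/8"
    using M1.exponent base by (simp add: V_def e_def powr_powr)
  obtain N :: nat where N: "V 1 / e < real N" using reals_Archimedean2 by blast
  then have N0: "N > 0" using e V_nonneg[of 1] by (cases "N = 0") (auto simp: field_simps)
  have pullN: "(pull ^^ N) x \<in> {0..e}" if x: "x \<in> {0..<1}" for x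
  proof -
    have "x powr (1 - \<alpha>) \<le> 1" using x M1.exponent by (intro powr_le1) auto
    then have "V x \<le> V 1" using M1.exponent by (auto simp: V_def intro!: divide_right_mono mult_left_le)
    then have "real N * (pull ^^ N) x \<le> V 1" using pull_pow_decay[OF x, of N] by simp
    also have "\<dots> \<le> real N * e" using N e by (simp add: field_simps)
    finally have "(pull ^^ N) x \<le> e" using N0 by simp
    then show ?thesis using pull_pow[OF x, of N] by simp
  qed
  define c where "c = (\<delta> / 3) ^ N * (1/2)"
  have "\<exists>n0. \<forall>n\<ge>n0. \<forall>x\<in>{0..<1}. ennreal c \<le> (P ^^ n) (uniform_density s) x" if s: "s \<in> {0<..1}" for s
  proof -
    obtain n1 :: nat where n1: "1 / s < real n1" using reals_Archimedean2 by blast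
    have half: "ennreal (1/2) \<le> (P ^^ n) (uniform_density s) e" if n: "n \<ge> n1" for n
    proof -
      let ?f = "(P ^^ n) (uniform_density s)" and ?z = "(pull ^^ n) e"
      have anti: "antimono_on unit_interval ?f" by (intro P_pow_antimono uniform_density_antimono)
      note [measurable] = borel_measurable_antimono_leb01[OF anti]
      have sets[measurable]: "{0..e} \<in> sets leb01" "{e<..1} \<in> sets leb01" using e by (auto simp: sets_leb01_iff)
      have z: "?z \<in> {0..<1}" using e by (intro pull_pow) auto
      have zs: "?z / s \<le> 1/8"
      proof -
        have n0: "1 / s < real n" using n n1 by simp
        then have "1 / s * ?z \<le> real n * ?z" using z by (intro mult_right_mono) auto
        also have "\<dots> \<le> V e" using e by (intro pull_pow_decay) auto
        finally show ?thesis using Ve by simp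
      qed
      have "(\<integral>\<^sup>+x. indicator {0..?z} x * uniform_density s x \<partial>leb01) = ennreal (1 / s) * emeasure leb01 ({0..?z} \<inter> {0..<s})"
        using z by (intro uniform_density_integral) (auto simp: sets_leb01_iff)
      also have "\<dots> \<le> ennreal (1 / s) * emeasure leb01 {0..?z}"
        using z by (intro mult_left_mono emeasure_mono) (auto simp: sets_leb01_iff)
      also have "\<dots> = ennreal (1 / s) * ennreal ?z" using z by (subst emeasure_leb01) auto
      also have "\<dots> = ennreal (?z / s)" using z s by (subst ennreal_mult[symmetric]) auto
      also have "\<dots> \<le> ennreal (1/8)" using zs by (rule ennreal_leI)
      finally have "(\<integral>\<^sup>+x. indicator {0..e} x * ?f x \<partial>leb01) \<le> ennreal (1/8) + ennreal (2 * V e)"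
        using mass_near_zero[OF uniform_density_antimono uniform_density_prob[OF s], of e n] e
        by (auto intro: order_trans add_right_mono)
      also have "\<dots> = ennreal (3/8)" by (simp add: Ve flip: ennreal_plus)
      finally have near: "(\<integral>\<^sup>+x. indicator {0..e} x * ?f x \<partial>leb01) \<le> ennreal (3/8)" .
      have far: "(\<integral>\<^sup>+x. indicator {e<..1} x * ?f x \<partial>leb01) \<le> ?f e"
      proof -
        have "(\<integral>\<^sup>+x. indicator {e<..1} x * ?f x \<partial>leb01) \<le> (\<integral>\<^sup>+x. ?f e * indicator {e<..1} x \<partial>leb01)"
          using anti e by (intro nn_integral_mono) (auto simp: indicator_def monotone_on_def)
        also have "\<dots> = ?f e * emeasure leb01 {e<..1}" by (rule nn_integral_cmult_indicator) measurable
        also have "emeasure leb01 {e<..1} = ennreal (1 - e)" using e by (subst emeasure_leb01) auto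
        also have "?f e * ennreal (1 - e) \<le> ?f e * 1" using e by (intro mult_left_mono) auto
        finally show ?thesis by simp
      qed
      have "1 = (\<integral>\<^sup>+x. ?f x \<partial>leb01)"
        by (simp add: P_pow_integral uniform_density_antimono uniform_density_prob[OF s])
      also have "\<dots> = (\<integral>\<^sup>+x. indicator {0..e} x * ?f x + indicator {e<..1} x * ?f x \<partial>leb01)"
        using e by (intro nn_integral_cong) (auto simp: indicator_def)
      also have "\<dots> = (\<integral>\<^sup>+x. indicator {0..e} x * ?f x \<partial>leb01) + (\<integral>\<^sup>+x. indicator {e<..1} x * ?f x \<partial>leb01)"
        by (rule nn_integral_add) measurable
      also have "\<dots> \<le> ennreal (3/8) + ?f e" by (intro add_mono near far)
      finally have "1 \<le> ennreal (3/8) + ?f e" .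
      show ?thesis
      proof (cases "?f e")
        case (real r)
        with \<open>1 \<le> ennreal (3/8) + ?f e\<close> have "ennreal 1 \<le> ennreal (3/8 + r)" by simp
        then have "1/2 \<le> r" using real by (subst (asm) ennreal_le_iff) auto
        then show ?thesis unfolding real by (rule ennreal_leI)
      qed simp
    qed
    have "ennreal c \<le> (P ^^ n) (uniform_density s) x" if n: "n \<ge> n1 + N" and x: "x \<in> {0..<1}" for n x
    proof -
      define m where "m = n - N"
      have m: "n = N + m" "n1 \<le> m" using n by (auto simp: m_def)
      let ?f = "(P ^^ m) (uniform_density s)"
      have "ennreal (1/2) \<le> ?f e" by (rule half[OF m(2)])
      also have "?f e \<le> ?f ((pull ^^ N) x)"
        using P_pow_antimono[OF uniform_density_antimono[of s], of m] pullN[OF x] e by (auto simp: monotone_on_def)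
      finally have "ennreal ((\<delta> / 3) ^ N) * ennreal (1/2) \<le> ennreal ((\<delta> / 3) ^ N) * ?f ((pull ^^ N) x)"
        by (intro mult_left_mono) auto
      also have "\<dots> \<le> (P ^^ N) ?f x" by (rule P_pow_ge_pull[OF x])
      also have "(P ^^ N) ?f x = (P ^^ n) (uniform_density s) x" by (simp add: m funpow_add)
      also have "ennreal ((\<delta> / 3) ^ N) * ennreal (1/2) = ennreal c"
        unfolding c_def using M1.lower(1) by (intro ennreal_mult[symmetric]) auto
      finally show ?thesis .
    qed
    then show ?thesis by blast
  qed
  moreover have "c > 0" using M1.lower(1) by (simp add: c_def)
  ultimately show ?thesis by blast
qed

section \<open>Existence and uniqueness of the invariant density\<close>

lemma P_mono: "(\<And>x. f x \<le> h x) \<Longrightarrow> P f x \<le> P h x"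
  unfolding P_def by (intro add_mono M1.transfer_op_mono M2.transfer_op_mono)

lemma P_SUP:
  assumes "incseq h"
  shows "P (SUP n. h n) x = (SUP n. P (h n) x)"
proof -
  have "incseq (\<lambda>n. transfer_op T1 p1 (h n) x)" "incseq (\<lambda>n. transfer_op T2 p2 (h n) x)"
    using assms by (auto simp: incseq_def le_fun_def intro!: M1.transfer_op_mono M2.transfer_op_mono)
  then show ?thesis
    unfolding P_def by (simp only: M1.transfer_op_SUP[OF assms] M2.transfer_op_SUP[OF assms] ennreal_SUP_add)
qed

text \<open>Invariance of the measure with density \<open>v\<close>, in terms of the dual operator. This avoids applying \<open>P\<close>
  to densities that are not decreasing.\<close>
definition stationary :: "(real \<Rightarrow> ennreal) \<Rightarrow> bool" where
  "stationary v \<longleftrightarrow> v \<in> borel_measurable leb01 \<and>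
     (\<forall>B\<in>sets leb01. (\<integral>\<^sup>+x. indicator B x * v x \<partial>leb01) = (\<integral>\<^sup>+x. U (indicator B) x * v x \<partial>leb01))"

lemma stationary_of_fixed_point:
  assumes f: "antimono_on unit_interval f" and fixed: "AE x in leb01. P f x = f x"
  shows "stationary f"
  unfolding stationary_def
proof (intro conjI ballI)
  show f_meas: "f \<in> borel_measurable leb01" by (rule borel_measurable_antimono_leb01[OF f])
  fix B assume B: "B \<in> sets leb01"
  have "(\<integral>\<^sup>+x. indicator B x * f x \<partial>leb01) = (\<integral>\<^sup>+x. indicator B x * P f x \<partial>leb01)"
    using fixed by (intro nn_integral_cong_AE) (auto elim!: eventually_mono)
  also have "\<dots> = (\<integral>\<^sup>+x. U (indicator B) x * f x \<partial>leb01)"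
    using B by (intro P_duality[OF f]) simp
  finally show "(\<integral>\<^sup>+x. indicator B x * f x \<partial>leb01) = (\<integral>\<^sup>+x. U (indicator B) x * f x \<partial>leb01)" .
qed

lemma stationary_cmult:
  assumes "stationary v" shows "stationary (\<lambda>x. a * v x)"
proof -
  have [measurable]: "v \<in> borel_measurable leb01" using assms by (simp add: stationary_def)
  have "(\<integral>\<^sup>+x. \<phi> x * (a * v x) \<partial>leb01) = a * (\<integral>\<^sup>+x. \<phi> x * v x \<partial>leb01)"
    if [measurable]: "\<phi> \<in> borel_measurable leb01" for \<phi>
    by (subst nn_integral_cmult[symmetric]) (auto simp: mult.left_commute)
  then show ?thesis using assms by (auto simp: stationary_def)
qed

text \<open>For \<open>l = liminf P^n 1\<close> one has \<open>P l \<le> l\<close>, because \<open>P\<close> is monotone and commutes with increasing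
  suprema. Fatou makes its integral finite, \<open>uniform_positivity\<close> makes it bounded
  below, and conservation of mass turns the inequality into an equality almost everywhere.\<close>
lemma ex_stationary:
  "\<exists>u c. stationary u \<and> (\<integral>\<^sup>+x. u x \<partial>leb01) = 1 \<and> 0 < c \<and> (\<forall>x\<in>{0..<1}. ennreal c \<le> u x)"
proof -
  obtain c n0 where c: "c > 0" and n0: "\<And>n x. n \<ge> n0 \<Longrightarrow> x \<in> {0..<1} \<Longrightarrow> ennreal c \<le> (P ^^ n) (uniform_density 1) x"
    using uniform_positivity by (metis greaterThanAtMost_iff order_refl zero_less_one)
  define f where "f n = (P ^^ n) (uniform_density 1)" for n
  define h where "h n x = (INF k\<in>{n..}. f k x)" for n x
  define l where "l = (SUP n. h n)"
  have f_anti: "antimono_on unit_interval (f n)" for n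
    unfolding f_def by (intro P_pow_antimono uniform_density_antimono)
  have h_anti: "antimono_on unit_interval (h n)" for n
    using f_anti unfolding h_def monotone_on_def by (intro ballI impI INF_mono') blast
  have l_anti: "antimono_on unit_interval l"
    using h_anti unfolding l_def monotone_on_def SUP_apply by (intro ballI impI SUP_mono') blast
  have h_inc: "incseq h" by (auto simp: h_def incseq_def le_fun_def intro!: INF_superset_mono)
  have l_liminf: "l x = liminf (\<lambda>n. f n x)" for x
    by (simp add: l_def h_def liminf_SUP_INF image_comp)
  \<comment> \<open>One application of \<open>P\<close> shifts the tail infimum \<open>h n\<close> to \<open>h (Suc n)\<close>.\<close>
  have Pl_le: "P l x \<le> l x" for x
  proof -
    have "P (h n) x \<le> h (Suc n) x" for n
      unfolding h_def[of "Suc n"]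
    proof (rule INF_greatest)
      fix k assume "k \<in> {Suc n..}"
      then obtain k' where k: "k = Suc k'" "k' \<ge> n" by (cases k) auto
      have "P (h n) x \<le> P (f k') x" using k by (intro P_mono) (auto simp: h_def intro!: INF_lower)
      then show "P (h n) x \<le> f k x" by (simp add: f_def k)
    qed
    also have "h (Suc n) x \<le> l x" for n
      unfolding l_def SUP_apply by (rule SUP_upper) simp
    finally show ?thesis unfolding l_def P_SUP[OF h_inc] by (intro SUP_least) (simp add: l_def)
  qed
  note [measurable] = borel_measurable_antimono_leb01[OF l_anti] borel_measurable_antimono_leb01[OF f_anti]
    borel_measurable_antimono_leb01[OF P_antimono[OF l_anti]]
  have "(\<integral>\<^sup>+x. l x \<partial>leb01) \<le> liminf (\<lambda>n. (\<integral>\<^sup>+x. f n x \<partial>leb01))"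
    unfolding l_liminf by (rule nn_integral_liminf) measurable
  also have "(\<lambda>n. (\<integral>\<^sup>+x. f n x \<partial>leb01)) = (\<lambda>n. 1)"
    by (simp add: f_def P_pow_integral[OF uniform_density_antimono] uniform_density_prob)
  finally have l_int: "(\<integral>\<^sup>+x. l x \<partial>leb01) \<le> 1" by (simp add: Liminf_const)
  have l_ge: "ennreal c \<le> l x" if "x \<in> {0..<1}" for x
    unfolding l_liminf using n0 that
    by (intro Liminf_bounded) (auto simp: eventually_sequentially f_def intro!: exI[of _ n0])
  have fixed: "AE x in leb01. P l x = l x"
    using Pl_le l_int P_integral[OF l_anti]
    by (intro AE_eq_of_le_of_nn_integral_le) (auto simp: top_unique)
  have st: "stationary l" using l_anti fixed by (rule stationary_of_fixed_point)
  obtain r where r: "(\<integral>\<^sup>+x. l x \<partial>leb01) = ennreal r" "0 \<le> r"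
    using l_int by (cases "\<integral>\<^sup>+x. l x \<partial>leb01") (auto simp: top_unique)
  have "ennreal c \<le> ennreal r" unfolding r(1)[symmetric] by (intro nn_integral_leb01_ge c l_ge)
  then have "c \<le> r" using r(2) by simp
  then have "0 < r" using c by simp
  have "r \<le> 1" using l_int r by (simp add: ennreal_le_1)
  let ?u = "\<lambda>x. ennreal (1 / r) * l x"
  have "(\<integral>\<^sup>+x. ?u x \<partial>leb01) = ennreal (1 / r) * ennreal r" by (simp add: nn_integral_cmult r(1))
  also have "\<dots> = 1" using \<open>0 < r\<close> by (subst ennreal_mult[symmetric]) auto
  finally have "(\<integral>\<^sup>+x. ?u x \<partial>leb01) = 1" .
  moreover have "ennreal c \<le> ?u x" if "x \<in> {0..<1}" for x
  proof -
    have "1 * ennreal c \<le> ennreal (1 / r) * l x"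
      using l_ge[OF that] \<open>r \<le> 1\<close> \<open>0 < r\<close> by (intro mult_mono) (auto simp: ennreal_ge_1)
    then show ?thesis by simp
  qed
  ultimately show ?thesis using stationary_cmult[OF st] c by blast
qed

lemma invariant_set_mass:
  assumes A: "A \<in> sets leb01" and inv: "AE x in leb01. U (indicator A) x = indicator A x"
    and f: "antimono_on unit_interval f"
  shows "(\<integral>\<^sup>+x. indicator A x * (P ^^ n) f x \<partial>leb01) = (\<integral>\<^sup>+x. indicator A x * f x \<partial>leb01)"
proof (induction n)
  case (Suc n)
  have "(\<integral>\<^sup>+x. indicator A x * (P ^^ Suc n) f x \<partial>leb01) = (\<integral>\<^sup>+x. U (indicator A) x * (P ^^ n) f x \<partial>leb01)"
    using P_duality[OF P_pow_antimono[OF f], of "indicator A" n] A by simp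
  also have "\<dots> = (\<integral>\<^sup>+x. indicator A x * (P ^^ n) f x \<partial>leb01)"
    using inv by (intro nn_integral_cong_AE) (auto elim!: eventually_mono)
  finally show ?case using Suc by simp
qed simp

text \<open>Let \<open>M\<close> be the supremum of the proportions \<open>q t\<close> of \<open>A\<close> in initial segments \<open>[0,t)\<close>. Invariance of \<open>A\<close> lets one
  compute \<open>q t\<close> after \<open>n\<close> steps, when the density is \<open>c + k\<close> with \<open>k\<close> decreasing of mass \<open>1 - c\<close>. The constant
  part sees the proportion of \<open>A\<close> in the whole interval, the part \<open>k\<close> at most \<open>M\<close>. Hence
  \<open>M \<le> c m(A) + (1 - c) M\<close>.\<close>
lemma invariant_set_initial_segments:
  assumes A: "A \<in> sets leb01" and inv: "AE x in leb01. U (indicator A) x = indicator A x"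
    and s: "s \<in> {0<..1}"
  shows "emeasure leb01 (A \<inter> {0..<s}) \<le> emeasure leb01 A * ennreal s"
proof -
  interpret finite_measure leb01 by (rule finite_measure_leb01)
  define q where "q t = ennreal (1 / t) * emeasure leb01 (A \<inter> {0..<t})" for t
  define M where "M = (SUP t\<in>{0<..1}. q t)"
  have q_eq: "emeasure leb01 (A \<inter> {0..<t}) = q t * ennreal t" if "t \<in> {0<..1}" for t
  proof -
    have "q t * ennreal t = emeasure leb01 (A \<inter> {0..<t}) * (ennreal (1 / t) * ennreal t)"
      by (simp add: q_def ac_simps)
    also have "ennreal (1 / t) * ennreal t = 1" using that by (subst ennreal_mult[symmetric]) auto
    finally show ?thesis by simp
  qed
  have seg: "emeasure leb01 (A \<inter> {0..<t}) \<le> M * ennreal t" if "t \<in> {0<..1}" for t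
    unfolding q_eq[OF that] M_def using that by (intro mult_right_mono SUP_upper) auto
  have q_mass: "q t = (\<integral>\<^sup>+x. indicator A x * uniform_density t x \<partial>leb01)" for t
    using uniform_density_integral[OF A, of t] by (simp add: q_def)
  have "M \<le> 1"
    unfolding M_def
  proof (rule SUP_least)
    fix t :: real assume t: "t \<in> {0<..1}"
    have "q t \<le> (\<integral>\<^sup>+x. uniform_density t x \<partial>leb01)"
      unfolding q_mass by (intro nn_integral_mono) (auto simp: indicator_def)
    then show "q t \<le> 1" by (simp add: uniform_density_prob[OF t])
  qed
  then obtain m where m: "M = ennreal m" "0 \<le> m" by (cases M) (auto simp: top_unique)
  obtain a where a: "emeasure leb01 A = ennreal a" "0 \<le> a"
    by (metis emeasure_eq_measure measure_nonneg)
  obtain c where c: "c > 0" and pos: "\<And>t. t \<in> {0<..1} \<Longrightarrow> \<exists>n. \<forall>x\<in>{0..<1}. ennreal c \<le> (P ^^ n) (uniform_density t) x"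
    using uniform_positivity by (meson order_refl)
  have improve: "q t \<le> ennreal (c * a + m * (1 - c)) \<and> c \<le> 1" if t: "t \<in> {0<..1}" for t
  proof -
    obtain n where n: "\<And>x. x \<in> {0..<1} \<Longrightarrow> ennreal c \<le> (P ^^ n) (uniform_density t) x" using pos[OF t] by blast
    define h where "h = (P ^^ n) (uniform_density t)"
    define k where "k x = h x - ennreal c" for x
    have h_anti: "antimono_on unit_interval h" unfolding h_def by (intro P_pow_antimono uniform_density_antimono)
    have k_anti: "antimono_on unit_interval k"
      using h_anti by (auto simp: k_def monotone_on_def intro!: ennreal_minus_mono)
    note [measurable] = borel_measurable_antimono_leb01[OF h_anti] borel_measurable_antimono_leb01[OF k_anti] A
    have AE1: "AE x in leb01. x \<noteq> 1"
      by (rule AE_leb01_neq)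
    have split: "AE x in leb01. h x = ennreal c + k x"
      using AE1 AE_space
    proof eventually_elim
      case (elim x)
      then have "ennreal c \<le> h x" using n[of x] by (simp add: h_def)
      then show ?case by (simp add: k_def add_diff_inverse_ennreal)
    qed
    have split_int: "(\<integral>\<^sup>+x. indicator B x * h x \<partial>leb01) = ennreal c * emeasure leb01 B + (\<integral>\<^sup>+x. k x * indicator B x \<partial>leb01)"
      if [measurable]: "B \<in> sets leb01" for B
    proof -
      have "(\<integral>\<^sup>+x. indicator B x * h x \<partial>leb01) = (\<integral>\<^sup>+x. ennreal c * indicator B x + k x * indicator B x \<partial>leb01)"
        using split by (intro nn_integral_cong_AE) (auto simp: indicator_def elim!: eventually_mono)
      also have "\<dots> = (\<integral>\<^sup>+x. ennreal c * indicator B x \<partial>leb01) + (\<integral>\<^sup>+x. k x * indicator B x \<partial>leb01)"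
        by (rule nn_integral_add) measurable
      finally show ?thesis by (simp add: nn_integral_cmult_indicator)
    qed
    have all: "unit_interval \<in> sets leb01" by (simp add: sets_leb01_iff)
    have "1 = (\<integral>\<^sup>+x. h x \<partial>leb01)"
      by (simp add: h_def P_pow_integral uniform_density_antimono uniform_density_prob[OF t])
    also have "\<dots> = (\<integral>\<^sup>+x. indicator unit_interval x * h x \<partial>leb01)"
      by (intro nn_integral_cong) (simp add: indicator_def)
    also have "\<dots> = ennreal c * emeasure leb01 unit_interval + (\<integral>\<^sup>+x. k x * indicator unit_interval x \<partial>leb01)"
      by (rule split_int[OF all])
    also have "emeasure leb01 unit_interval = 1" by (subst emeasure_leb01) auto
    also have "(\<integral>\<^sup>+x. k x * indicator unit_interval x \<partial>leb01) = (\<integral>\<^sup>+x. k x \<partial>leb01)"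
      by (intro nn_integral_cong) (simp add: indicator_def)
    finally have total: "1 = ennreal c + (\<integral>\<^sup>+x. k x \<partial>leb01)" by simp
    then obtain r where r: "(\<integral>\<^sup>+x. k x \<partial>leb01) = ennreal r" "0 \<le> r"
      by (cases "\<integral>\<^sup>+x. k x \<partial>leb01") auto
    have "ennreal 1 = ennreal (c + r)" using total r c by simp
    then have r1: "r = 1 - c" using r c by (subst (asm) ennreal_inj) auto
    have "q t = (\<integral>\<^sup>+x. indicator A x * h x \<partial>leb01)"
      unfolding q_mass h_def by (rule invariant_set_mass[OF A inv uniform_density_antimono, symmetric])
    also have "\<dots> = ennreal c * ennreal a + (\<integral>\<^sup>+x. k x * indicator A x \<partial>leb01)"
      by (simp add: split_int[OF A] a)
    also have "\<dots> \<le> ennreal c * ennreal a + M * ennreal r"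
      using nn_integral_antimono_le[OF k_anti A seg] by (simp add: r add_left_mono)
    also have "\<dots> = ennreal (c * a + m * (1 - c))"
      using r r1 a c m by (simp add: ennreal_mult ennreal_plus)
    finally show ?thesis using r r1 by simp
  qed
  have "M \<le> ennreal (c * a + m * (1 - c))"
    unfolding M_def using improve by (intro SUP_least) auto
  moreover have "c \<le> 1" using improve[OF s] by simp
  ultimately have "m \<le> c * a + m * (1 - c)"
    unfolding m(1) using m(2) a(2) c by (subst (asm) ennreal_le_iff) auto
  then have "c * m \<le> c * a" by (simp add: algebra_simps)
  then have "m \<le> a" using c by simp
  then have "M * ennreal s \<le> emeasure leb01 A * ennreal s"
    unfolding m a by (intro mult_right_mono ennreal_leI) auto
  with seg[OF s] show ?thesis by (rule order_trans)
qed

lemma U_complement: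
  assumes x: "x \<in> unit_interval"
  shows "U (indicator A) x + U (indicator (unit_interval - A)) x = 1"
proof -
  have *: "indicator A y + indicator (unit_interval - A) y = (1 :: ennreal)" if "y \<in> unit_interval" for y
    using that by (auto simp: indicator_def)
  have "U (indicator A) x + U (indicator (unit_interval - A)) x =
     (indicator A (T1 x) + indicator (unit_interval - A) (T1 x)) * ennreal (p1 x) +
     (indicator A (T2 x) + indicator (unit_interval - A) (T2 x)) * ennreal (p2 x)"
    unfolding U_def by (simp only: distrib_right add.assoc add.left_commute)
  also have "\<dots> = 1"
    using x M1.T_range M2.T_range by (simp only: *[OF funcset_mem] mult_1 p_sum_ennreal)
  finally show ?thesis .
qed

text \<open>The previous bound for \<open>A\<close> and for its complement adds up to an equality, so \<open>A\<close> occupies the same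
  proportion \<open>a\<close> of each initial segment. Then Lebesgue measure restricted to \<open>A\<close> is \<open>a\<close> times Lebesgue
  measure on the interval; evaluating both on \<open>A\<close> gives \<open>a = a^2\<close>.\<close>
lemma invariant_set_trivial:
  assumes A: "A \<in> sets leb01" and inv: "AE x in leb01. U (indicator A) x = indicator A x"
  shows "emeasure leb01 A = 0 \<or> emeasure leb01 (unit_interval - A) = 0"
proof -
  interpret finite_measure leb01 by (rule finite_measure_leb01)
  let ?B = "unit_interval - A" and ?m = "measure leb01"
  have A': "A \<in> sets borel" "A \<subseteq> unit_interval" using A by (auto simp: sets_leb01_iff)
  have B: "?B \<in> sets leb01" using A by (auto simp: sets_leb01_iff)
  have invB: "AE x in leb01. U (indicator ?B) x = indicator ?B x"
    using inv AE_space
  proof eventually_elim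
    case (elim x)
    then have "indicator A x + U (indicator ?B) x = 1" using U_complement[of x A] by simp
    moreover have "indicator A x + indicator ?B x = (1 :: ennreal)" using elim by (auto simp: indicator_def)
    ultimately have "indicator A x + U (indicator ?B) x = indicator A x + indicator ?B x" by simp
    then show ?case by (cases "x \<in> A") (auto simp: ennreal_add_left_cancel)
  qed
  define a where "a = ?m A"
  have one: "?m unit_interval = 1" by (simp add: measure_def emeasure_leb01)
  have mB: "?m ?B = 1 - a"
    using finite_measure_compl[OF A] one by (simp add: a_def)
  have ini: "?m {0..<s} = s" if "s \<in> {0<..1}" for s
    using that by (subst measure_def, subst emeasure_leb01) auto
  have seg: "?m (A \<inter> {0..<s}) = a * s" if s: "s \<in> {0<..1}" for s
  proof -
    have S: "{0..<s} \<in> sets leb01" using s by (auto simp: sets_leb01_iff)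
    have le: "?m (X \<inter> {0..<s}) \<le> ?m X * s" if "X \<in> sets leb01" "AE x in leb01. U (indicator X) x = indicator X x" for X
    proof -
      have "ennreal (?m (X \<inter> {0..<s})) \<le> ennreal (?m X * s)"
        using invariant_set_initial_segments[OF that s] s by (simp add: emeasure_eq_measure ennreal_mult)
      then show ?thesis using s by (subst (asm) ennreal_le_iff) auto
    qed
    have "?m (A \<inter> {0..<s}) + ?m (?B \<inter> {0..<s}) = ?m ((A \<inter> {0..<s}) \<union> (?B \<inter> {0..<s}))"
      using A B S by (intro finite_measure_Union[symmetric] sets.Int) auto
    also have "(A \<inter> {0..<s}) \<union> (?B \<inter> {0..<s}) = {0..<s}" using s by auto
    finally have "?m (A \<inter> {0..<s}) + ?m (?B \<inter> {0..<s}) = s" using ini[OF s] by simp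
    moreover have "?m (A \<inter> {0..<s}) \<le> a * s" using le[OF A inv] by (simp add: a_def)
    moreover have "?m (?B \<inter> {0..<s}) \<le> (1 - a) * s" using le[OF B invB] mB by simp
    ultimately show ?thesis by (simp add: algebra_simps)
  qed
  have ray: "?m (A \<inter> {x<..}) = a * ?m (unit_interval \<inter> {x<..})" for x
  proof -
    consider "x < 0" | "1 \<le> x" | "x \<in> {0..<1}" by force
    then show ?thesis
    proof cases
      case 1
      then have "A \<inter> {x<..} = A" "unit_interval \<inter> {x<..} = unit_interval" using A'(2) by auto
      then show ?thesis by (simp only: one a_def mult_1_right)
    next
      case 2
      then have "A \<inter> {x<..} = {}" "unit_interval \<inter> {x<..} = {}" using A'(2) by auto
      then show ?thesis by (simp only: measure_empty mult_zero_right)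
    next
      case 3
      have S: "A \<inter> {0..x} \<in> sets leb01" "A \<inter> {0..<x} \<in> sets leb01"
        using A' 3 by (auto simp: sets_leb01_iff)
      have "AE z in leb01. z \<in> A \<inter> {0..x} \<longleftrightarrow> z \<in> A \<inter> {0..<x}"
        using AE_leb01_neq[of x] by eventually_elim auto
      then have "?m (A \<inter> {0..x}) = ?m (A \<inter> {0..<x})"
        using S by (rule measure_eq_AE)
      also have "\<dots> = a * x" using seg[of x] 3 by (cases "x = 0") auto
      finally have "?m (A - A \<inter> {0..x}) = a - a * x"
        using finite_measure_Diff[OF A S(1)] by (simp add: a_def)
      also have "A - A \<inter> {0..x} = A \<inter> {x<..}" using A'(2) 3 by auto
      finally have "?m (A \<inter> {x<..}) = a * (1 - x)" by (simp add: algebra_simps)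
      moreover have "unit_interval \<inter> {x<..} = {x<..1}" using 3 by auto
      moreover have "?m {x<..1} = 1 - x" using 3 by (subst measure_def, subst emeasure_leb01) auto
      ultimately show ?thesis by (simp only:)
    qed
  qed
  have dens: "emeasure (density lborel (\<lambda>x. ennreal k * indicator X x)) Y = ennreal (k * ?m (X \<inter> Y))"
    if "X \<in> sets leb01" "Y \<in> sets borel" "0 \<le> k" for X Y k
  proof -
    have X: "X \<in> sets borel" "X \<subseteq> unit_interval" using that by (auto simp: sets_leb01_iff)
    have "emeasure (density lborel (\<lambda>x. ennreal k * indicator X x)) Y =
        (\<integral>\<^sup>+x. ennreal k * indicator X x * indicator Y x \<partial>lborel)"
      using X that by (subst emeasure_density) auto
    also have "\<dots> = (\<integral>\<^sup>+x. ennreal k * indicator (X \<inter> Y) x \<partial>lborel)"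
      by (intro nn_integral_cong) (simp add: indicator_def)
    also have "\<dots> = ennreal k * emeasure lborel (X \<inter> Y)"
      using X that by (intro nn_integral_cmult_indicator) auto
    also have "emeasure lborel (X \<inter> Y) = ennreal (?m (X \<inter> Y))"
      using X by (subst emeasure_leb01[symmetric]) (auto simp: emeasure_eq_measure)
    finally show ?thesis using that by (simp add: ennreal_mult)
  qed
  have I: "unit_interval \<in> sets leb01" by (simp add: sets_leb01_iff)
  have a0: "0 \<le> a" by (simp add: a_def)
  have "density lborel (\<lambda>x. ennreal 1 * indicator A x) = density lborel (\<lambda>x. ennreal a * indicator unit_interval x)"
  proof (rule measure_eqI_lessThan)
    fix x :: real
    have ray_borel: "{x<..} \<in> sets borel" by simp
    show "emeasure (density lborel (\<lambda>x. ennreal 1 * indicator A x)) {x<..} < \<infinity>"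
      unfolding dens[OF A ray_borel zero_le_one] by simp
    show "emeasure (density lborel (\<lambda>x. ennreal 1 * indicator A x)) {x<..} =
        emeasure (density lborel (\<lambda>x. ennreal a * indicator unit_interval x)) {x<..}"
      unfolding dens[OF A ray_borel zero_le_one] dens[OF I ray_borel a0] ray by simp
  qed simp_all
  then have "ennreal (1 * ?m (A \<inter> A)) = ennreal (a * ?m (unit_interval \<inter> A))"
    using dens[OF A A'(1), of 1] dens[OF I A'(1) a0] by simp
  moreover have "unit_interval \<inter> A = A" using A'(2) by blast
  ultimately have "a = a * a" using a0 by (simp add: a_def)
  then have "a = 0 \<or> a = 1" by simp
  then show ?thesis using mB by (auto simp: a_def emeasure_eq_measure)
qed

text \<open>On \<open>A = {u < v}\<close> and its complement \<open>B\<close>, stationarity balances the flow from \<open>A\<close> to \<open>B\<close> with the flow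
  from \<open>B\<close> to \<open>A\<close>. The latter is not larger for \<open>v\<close> than for \<open>u\<close>, the former not smaller; so both flows
  agree for \<open>u\<close> and \<open>v\<close>. As \<open>u < v\<close> on \<open>A\<close>, nothing flows from \<open>A\<close> to \<open>B\<close>, and by balance nothing flows
  back, where positivity of \<open>u\<close> is used. Thus \<open>A\<close> is invariant, hence \<open>A\<close> or \<open>B\<close> is null, and two
  comparable densities with equal integrals coincide.\<close>
lemma stationary_unique:
  assumes u: "stationary u" "(\<integral>\<^sup>+x. u x \<partial>leb01) = 1" "AE x in leb01. 0 < u x"
    and v: "stationary v" "(\<integral>\<^sup>+x. v x \<partial>leb01) = 1"
  shows "AE x in leb01. u x = v x"
proof -
  have [measurable]: "u \<in> borel_measurable leb01" "v \<in> borel_measurable leb01"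
    using u v by (simp_all add: stationary_def)
  define A where "A = {x \<in> space leb01. u x < v x}"
  define B where "B = unit_interval - A"
  have A[measurable]: "A \<in> sets leb01" unfolding A_def by measurable
  have B[measurable]: "B \<in> sets leb01" unfolding B_def using A by (auto simp: sets_leb01_iff)
  have part: "x \<in> A \<longleftrightarrow> x \<notin> B" if "x \<in> unit_interval" for x using that by (auto simp: B_def A_def)
  let ?AB = "\<lambda>w. \<integral>\<^sup>+x. indicator A x * U (indicator B) x * w x \<partial>leb01"
  let ?BA = "\<lambda>w. \<integral>\<^sup>+x. indicator B x * U (indicator A) x * w x \<partial>leb01"
  \<comment> \<open>The mass flowing from \<open>A\<close> to \<open>B\<close> equals the mass flowing from \<open>B\<close> to \<open>A\<close>.\<close>
  have fin: "?AB w < \<infinity> \<and> ?AB w = ?BA w" if w: "stationary w" "(\<integral>\<^sup>+x. w x \<partial>leb01) = 1" for w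
  proof -
    have [measurable]: "w \<in> borel_measurable leb01" using w by (simp add: stationary_def)
    let ?AA = "\<integral>\<^sup>+x. indicator A x * U (indicator A) x * w x \<partial>leb01"
    have "?AA + ?AB w = (\<integral>\<^sup>+x. indicator A x * U (indicator A) x * w x + indicator A x * U (indicator B) x * w x \<partial>leb01)"
      by (rule nn_integral_add[symmetric]) measurable
    also have "\<dots> = (\<integral>\<^sup>+x. indicator A x * w x \<partial>leb01)"
    proof (rule nn_integral_cong)
      fix x assume "x \<in> space leb01"
      then have "U (indicator A) x + U (indicator B) x = 1" using U_complement[of x A] by (simp add: B_def)
      then show "indicator A x * U (indicator A) x * w x + indicator A x * U (indicator B) x * w x = indicator A x * w x"
        by (metis distrib_left distrib_right mult.right_neutral)
    qed
    also have "\<dots> = (\<integral>\<^sup>+x. U (indicator A) x * w x \<partial>leb01)"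
      using w A by (simp add: stationary_def)
    also have "\<dots> = (\<integral>\<^sup>+x. indicator A x * U (indicator A) x * w x + indicator B x * U (indicator A) x * w x \<partial>leb01)"
      by (intro nn_integral_cong) (auto simp: B_def indicator_def)
    also have "\<dots> = ?AA + ?BA w"
      by (rule nn_integral_add) measurable
    finally have sum: "?AA + ?AB w = ?AA + ?BA w" .
    have le: "U (indicator X) x * w x \<le> w x" if "x \<in> unit_interval" for X x
    proof -
      have "U (indicator X) x \<le> 1" using U_complement[OF that, of X] by (metis le_iff_add)
      then show ?thesis using mult_right_mono[of _ 1 "w x"] by simp
    qed
    have "?AA \<le> (\<integral>\<^sup>+x. w x \<partial>leb01)" "?AB w \<le> (\<integral>\<^sup>+x. w x \<partial>leb01)"
      using le by (auto intro!: nn_integral_mono simp: indicator_def)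
    with w have "?AA < \<infinity>" "?AB w < \<infinity>" by (auto simp: less_top[symmetric] top_unique)
    with sum show ?thesis by (auto simp: ennreal_add_left_cancel)
  qed
  have "?AB v = ?BA v" using fin v by simp
  also have "\<dots> \<le> ?BA u"
    by (intro nn_integral_mono) (auto simp: indicator_def B_def A_def intro!: mult_left_mono)
  also have "\<dots> = ?AB u" using fin u by simp
  finally have AB_le: "?AB v \<le> ?AB u" .
  have "AE x in leb01. indicator A x * U (indicator B) x * u x = indicator A x * U (indicator B) x * v x"
  proof (rule AE_eq_of_le_of_nn_integral_le)
    show "AE x in leb01. indicator A x * U (indicator B) x * u x \<le> indicator A x * U (indicator B) x * v x"
      by (rule AE_I2) (auto simp: indicator_def A_def intro!: mult_left_mono)
    show "?AB u \<noteq> \<infinity>" using fin[OF u(1,2)] by auto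
  qed (use AB_le in simp_all)
  moreover have "AE x in leb01. U (indicator A) x + U (indicator B) x = 1"
    by (rule AE_I2) (simp add: B_def U_complement)
  ultimately have onA: "AE x in leb01. x \<in> A \<longrightarrow> U (indicator B) x = 0"
  proof eventually_elim
    case (elim x)
    show ?case
    proof
      assume x: "x \<in> A"
      then have eq: "U (indicator B) x * u x = U (indicator B) x * v x" and less: "u x < v x"
        using elim by (auto simp: A_def)
      have "U (indicator B) x \<noteq> top" using elim(2) by (metis ennreal_add_eq_top ennreal_one_neq_top)
      then show "U (indicator B) x = 0"
        using eq less by (auto simp: ennreal_mult_cancel_left)
    qed
  qed
  then have "?AB u = (\<integral>\<^sup>+x. 0 \<partial>leb01)"
    by (intro nn_integral_cong_AE) (auto simp: indicator_def elim!: eventually_mono)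
  then have "?BA u = 0" using fin u by simp
  then have "AE x in leb01. indicator B x * U (indicator A) x * u x = 0"
    by (subst (asm) nn_integral_0_iff_AE) auto
  with u(3) have onB: "AE x in leb01. x \<in> B \<longrightarrow> U (indicator A) x = 0"
    by eventually_elim (auto simp: indicator_def)
  have "AE x in leb01. U (indicator A) x = indicator A x"
    using onA onB AE_space
  proof eventually_elim
    case (elim x)
    then show ?case using U_complement[of x A] part[of x] by (auto simp: B_def[symmetric] indicator_def)
  qed
  then consider "emeasure leb01 A = 0" | "emeasure leb01 B = 0"
    using invariant_set_trivial[OF A] by (auto simp: B_def)
  then show ?thesis
  proof cases
    case 1
    then have "AE x in leb01. x \<notin> A" using A by (intro AE_not_in) auto
    then have "AE x in leb01. v x \<le> u x" using AE_space by eventually_elim (auto simp: A_def)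
    then have "AE x in leb01. v x = u x" using u v by (intro AE_eq_of_le_of_nn_integral_le) auto
    then show ?thesis by eventually_elim simp
  next
    case 2
    then have "AE x in leb01. x \<notin> B" using B by (intro AE_not_in) auto
    then have "AE x in leb01. u x \<le> v x" using AE_space by eventually_elim (auto simp: A_def B_def)
    then show ?thesis using u v by (intro AE_eq_of_le_of_nn_integral_le) auto
  qed
qed

lemma random_map_invariant_density_iff:
  assumes [measurable]: "v \<in> borel_measurable leb01"
  shows "random_map_invariant T1 T2 p1 p2 (density leb01 v) \<longleftrightarrow> stationary v"
proof -
  have "emeasure (density leb01 v) B = (\<integral>\<^sup>+x. indicator B x * v x \<partial>leb01)" if "B \<in> sets leb01" for B
    using that by (simp add: emeasure_density mult.commute)
  moreover have "(\<integral>\<^sup>+x\<in>T1 -` B. ennreal (p1 x) \<partial>density leb01 v) + (\<integral>\<^sup>+x\<in>T2 -` B. ennreal (p2 x) \<partial>density leb01 v)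
      = (\<integral>\<^sup>+x. U (indicator B) x * v x \<partial>leb01)" if [measurable]: "B \<in> sets leb01" for B
  proof -
    have "(\<integral>\<^sup>+x\<in>T1 -` B. ennreal (p1 x) \<partial>density leb01 v) = (\<integral>\<^sup>+x. v x * (ennreal (p1 x) * indicator B (T1 x)) \<partial>leb01)"
      "(\<integral>\<^sup>+x\<in>T2 -` B. ennreal (p2 x) \<partial>density leb01 v) = (\<integral>\<^sup>+x. v x * (ennreal (p2 x) * indicator B (T2 x)) \<partial>leb01)"
      unfolding indicator_vimage by (rule nn_integral_density; measurable)+
    moreover have "(\<integral>\<^sup>+x. v x * (ennreal (p1 x) * indicator B (T1 x)) \<partial>leb01) + (\<integral>\<^sup>+x. v x * (ennreal (p2 x) * indicator B (T2 x)) \<partial>leb01)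
      = (\<integral>\<^sup>+x. v x * (ennreal (p1 x) * indicator B (T1 x)) + v x * (ennreal (p2 x) * indicator B (T2 x)) \<partial>leb01)"
      by (rule nn_integral_add[symmetric]) measurable
    ultimately show ?thesis by (simp add: U_def algebra_simps)
  qed
  ultimately show ?thesis
    by (simp add: random_map_invariant_def stationary_def sets_leb01[symmetric])
qed

text \<open>By the Radon-Nikodym theorem.\<close>
lemma acim_iff:
  "acim T1 T2 p1 p2 \<mu> \<longleftrightarrow>
     (\<exists>v. stationary v \<and> (\<integral>\<^sup>+x. v x \<partial>leb01) = 1 \<and> \<mu> = density leb01 v)"
proof
  interpret finite_measure leb01 by (rule finite_measure_leb01)
  assume \<mu>: "acim T1 T2 p1 p2 \<mu>"
  then have "sets \<mu> = sets leb01" by (simp add: acim_def random_map_invariant_def sets_leb01)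
  then obtain v where v[measurable]: "v \<in> borel_measurable leb01" and eq: "density leb01 v = \<mu>"
    using Radon_Nikodym[of \<mu>] \<mu> by (auto simp: acim_def)
  have "stationary v" using \<mu> v eq by (simp add: acim_def flip: random_map_invariant_density_iff)
  moreover have "(\<integral>\<^sup>+x. v x \<partial>leb01) = 1"
  proof -
    have "emeasure (density leb01 v) (space (density leb01 v)) = 1"
      using \<mu> eq by (simp add: acim_def prob_space.emeasure_space_1)
    moreover have "emeasure (density leb01 v) (space leb01) = (\<integral>\<^sup>+x. v x * indicator (space leb01) x \<partial>leb01)"
      by (rule emeasure_density) auto
    ultimately show ?thesis by (simp add: nn_integral_cong[of leb01 "\<lambda>x. v x * indicator (space leb01) x" v] del: space_leb01)
  qed
  ultimately show "\<exists>v. stationary v \<and> (\<integral>\<^sup>+x. v x \<partial>leb01) = 1 \<and> \<mu> = density leb01 v" using eq by blast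
next
  assume "\<exists>v. stationary v \<and> (\<integral>\<^sup>+x. v x \<partial>leb01) = 1 \<and> \<mu> = density leb01 v"
  then obtain v where v: "stationary v" "(\<integral>\<^sup>+x. v x \<partial>leb01) = 1" "\<mu> = density leb01 v" by blast
  then have [measurable]: "v \<in> borel_measurable leb01" by (simp add: stationary_def)
  have "prob_space (density leb01 v)"
  proof (rule prob_spaceI)
    have "emeasure (density leb01 v) (space leb01) = (\<integral>\<^sup>+x. v x * indicator (space leb01) x \<partial>leb01)"
      by (rule emeasure_density) auto
    also have "\<dots> = 1" by (simp add: v nn_integral_cong[of leb01 "\<lambda>x. v x * indicator (space leb01) x" v] del: space_leb01)
    finally show "emeasure (density leb01 v) (space (density leb01 v)) = 1" by simp
  qed
  moreover have "absolutely_continuous leb01 (density leb01 v)"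
    by (rule absolutely_continuousI_density) measurable
  ultimately show "acim T1 T2 p1 p2 \<mu>"
    using v by (simp add: acim_def random_map_invariant_density_iff)
qed

lemma unique_acim_with_positive_density:
  "\<exists>\<mu>. acim T1 T2 p1 p2 \<mu> \<and> (\<forall>\<nu>. acim T1 T2 p1 p2 \<nu> \<longrightarrow> \<nu> = \<mu>) \<and>
     (\<exists>\<rho>. is_density \<mu> \<rho>) \<and>
     (\<forall>\<rho>. is_density \<mu> \<rho> \<longrightarrow> (\<exists>c>0. AE x in leb01. \<rho> x \<ge> c))"
proof -
  interpret finite_measure leb01 by (rule finite_measure_leb01)
  obtain u c where u: "stationary u" "(\<integral>\<^sup>+x. u x \<partial>leb01) = 1"
    and c: "0 < c" "\<And>x. x \<in> {0..<1} \<Longrightarrow> ennreal c \<le> u x"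
    using ex_stationary by blast
  have [measurable]: "u \<in> borel_measurable leb01" using u by (simp add: stationary_def)
  have "AE x in leb01. x \<noteq> 1"
    by (rule AE_leb01_neq)
  then have u_ge: "AE x in leb01. ennreal c \<le> u x"
    using AE_space by eventually_elim (use c(2) in auto)
  then have u_pos: "AE x in leb01. 0 < u x"
    by eventually_elim (rule less_le_trans[of _ "ennreal c"], use c(1) in simp_all)
  define \<mu> where "\<mu> = density leb01 u"
  have "acim T1 T2 p1 p2 \<mu>" using u by (auto simp: acim_iff \<mu>_def)
  moreover have "\<nu> = \<mu>" if \<nu>: "acim T1 T2 p1 p2 \<nu>" for \<nu>
  proof -
    obtain v where v: "stationary v" "(\<integral>\<^sup>+x. v x \<partial>leb01) = 1" "\<nu> = density leb01 v"
      using \<nu> by (auto simp: acim_iff)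
    then have "v \<in> borel_measurable leb01" by (simp add: stationary_def)
    then have "density leb01 u = density leb01 v"
      using stationary_unique[OF u u_pos v(1,2)] by (intro density_cong) auto
    then show ?thesis by (simp add: v \<mu>_def)
  qed
  moreover have "is_density \<mu> (\<lambda>x. enn2real (u x))"
  proof -
    have "AE x in leb01. u x \<noteq> \<infinity>" using u by (intro nn_integral_PInf_AE) auto
    then have "AE x in leb01. u x = ennreal (enn2real (u x))"
      by eventually_elim (simp add: less_top)
    then have "density leb01 u = density leb01 (\<lambda>x. ennreal (enn2real (u x)))"
      by (intro density_cong) auto
    then show ?thesis by (simp add: is_density_def \<mu>_def)
  qed
  moreover have "\<exists>c>0. AE x in leb01. \<rho> x \<ge> c" if \<rho>: "is_density \<mu> \<rho>" for \<rho>
  proof -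
    have [measurable]: "\<rho> \<in> borel_measurable leb01" using \<rho> by (simp add: is_density_def)
    have "density leb01 u = density leb01 (\<lambda>x. ennreal (\<rho> x))" using \<rho> by (simp add: is_density_def \<mu>_def)
    then have "AE x in leb01. u x = ennreal (\<rho> x)" by (intro density_unique) auto
    with u_ge have "AE x in leb01. \<rho> x \<ge> c"
      using AE_space
    proof eventually_elim
      case (elim x)
      then have "ennreal c \<le> ennreal (\<rho> x)" "0 \<le> \<rho> x" using \<rho> by (auto simp: is_density_def)
      then show ?case by simp
    qed
    then show ?thesis using c(1) by blast
  qed
  ultimately show ?thesis by blast
qed

end

theorem theorem3p1:
  fixes \<alpha> \<beta> :: real and g1 g2 p1 p2 T1 T2 :: "real \<Rightarrow> real"
  assumes "0 < \<beta>" and "\<beta> < \<alpha>" and "\<alpha> < 1"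
    and "right_branch g1" and "right_branch g2"
    and "T1 = intermittent_map \<alpha> g1" and "T2 = intermittent_map \<beta> g2"
    and "p1 \<in> borel_measurable borel01" and "p2 \<in> borel_measurable borel01"
    and "p1 \<in> unit_interval \<rightarrow> unit_interval" and "p2 \<in> unit_interval \<rightarrow> unit_interval"
    and "\<forall>x\<in>unit_interval. p1 x + p2 x = 1"
    and "condition_A T1 p1" and "condition_A T2 p2"
    and "condition_B p1 p2"
  shows "\<exists>\<mu>. acim T1 T2 p1 p2 \<mu> \<and> (\<forall>\<nu>. acim T1 T2 p1 p2 \<nu> \<longrightarrow> \<nu> = \<mu>) \<and>
           (\<exists>\<rho>. is_density \<mu> \<rho>) \<and>
           (\<forall>\<rho>. is_density \<mu> \<rho> \<longrightarrow> (\<exists>c>0. AE x in leb01. \<rho> x \<ge> c))"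
proof -
  obtain \<delta> where \<delta>: "\<delta> > 0" "\<delta> \<le> (INF x\<in>unit_interval. p1 x)" "\<delta> \<le> (INF x\<in>unit_interval. p2 x)"
    using assms(15) by (auto simp: condition_B_def)
  have lower: "\<delta> \<le> p x" if "p \<in> unit_interval \<rightarrow> unit_interval" "\<delta> \<le> (INF x\<in>unit_interval. p x)" "x \<in> unit_interval"
    for p :: "real \<Rightarrow> real" and x
  proof -
    have "bdd_below (p ` unit_interval)" using that(1) by (intro bdd_belowI[of _ 0]) auto
    then have "(INF x\<in>unit_interval. p x) \<le> p x" using that(3) by (rule cINF_lower)
    with that(2) show ?thesis by simp
  qed
  interpret intermittent_random_map \<alpha> \<beta> \<delta> g1 g2 p1 p2 T1 T2
    by unfold_locales (use assms \<delta>(1) lower[OF assms(10) \<delta>(2)] lower[OF assms(11) \<delta>(3)] in auto)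
  show ?thesis by (rule unique_acim_with_positive_density)
qed

end
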